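(* Let $1\le p<\infty$ and let $(U,V)$ be a pair of $n\times n$ matrix weights on $\mathbb{R}^d$ in $A_p$. Let $\varphi\in C_c^\infty(B(0,1))$ be a non-negative, radially symmetric and decreasing function with $\|\varphi\|_1=1$, and for $t>0$ let $\varphi_t(x)=t^{-d}\varphi(x/t)$. Then there is a constant $C$ such that for all $f\in L^p(V)$, $$\sup_{t>0}\|\varphi_t*f\|_{L^p(U)}\le C\|f\|_{L^p(V)}.$$ Moreover, for all $f\in L^p(V)$, $$\lim_{t\to0}\|\varphi_t*f-f\|_{L^p(U)}=0.$$
   Context: Cubes have edges parallel to the coordinate axes; $p'$ is the conjugate exponent of $p$; $B(0,1)\subset\mathbb{R}^d$ is the unit ball. A matrix weight is an $n\times n$ self-adjoint matrix function $U$ on $\mathbb{R}^d$ with locally integrable entries such that $U(x)$ is positive definite for a.e. $x$; powers $U^r$ are defined by diagonalization. $|\cdot|_{\mathrm{op}}$ is the operator norm. $L^p(U)$ is the set of measurable $f:\mathbb{R}^d\to\mathbb{C}^n$ with $\|f\|_{L^p(U)}=\big(\int|U^{1/p}f|^p\,dx\big)^{1/p}<\infty$. Convolution of a scalar function with a vector-valued function is componentwise. $(U,V)\in A_p$ means, for $p>1$, $$\sup_Q\left(\frac1{|Q|}\int_Q\Big(\frac1{|Q|}\int_Q|U(x)^{\frac1p}V(y)^{-\frac1p}|_{\mathrm{op}}^{p'}\,dy\Big)^{\frac{p}{p'}}dx\right)^{\frac1p}<\infty,$$ and for $p=1$, $\sup_Q\operatorname*{ess\,sup}_{y\in Q}\frac1{|Q|}\int_Q|U(x)V(y)^{-1}|_{\mathrm{op}}\,dx<\infty$.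 *)

theory Defs
  imports "HOL-Analysis.Analysis" "HOL-Probability.Essential_Supremum"
begin

section \<open>Complex matrices\<close>

definition ctranspose :: "complex^'n^'m \<Rightarrow> complex^'m^'n" where
  "ctranspose A = (\<chi> i j. cnj (A $ j $ i))"

definition self_adjoint :: "complex^'n^'n \<Rightarrow> bool" where
  "self_adjoint A \<longleftrightarrow> ctranspose A = A"

definition unitary :: "complex^'n^'n \<Rightarrow> bool" where
  "unitary P \<longleftrightarrow> ctranspose P ** P = mat 1 \<and> P ** ctranspose P = mat 1"

definition pos_def :: "complex^'n^'n \<Rightarrow> bool" where
  "pos_def A \<longleftrightarrow> self_adjoint A \<and>
     (\<forall>v. v \<noteq> 0 \<longrightarrow> 0 < Re (\<Sum>i\<in>UNIV. cnj (v $ i) * (A *v v) $ i))"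

definition real_diag :: "real^'n \<Rightarrow> complex^'n^'n" where
  "real_diag l = (\<chi> i j. if i = j then complex_of_real (l $ i) else 0)"

text \<open>
  Real powers by diagonalization. The result does not depend on the chosen diagonalization
  (lemma \<open>mat_powr_diagonalized\<close> below), so the definite description is meaningful for every
  self-adjoint matrix; it is only of interest for positive definite ones.
\<close>

definition mat_powr :: "complex^'n^'n \<Rightarrow> real \<Rightarrow> complex^'n^'n" where
  "mat_powr A r = (THE B. \<exists>P l. unitary P \<and> A = P ** real_diag l ** ctranspose P \<and>
     B = P ** real_diag (\<chi> i. l $ i powr r) ** ctranspose P)"

lemma real_diag_mult: "(real_diag l ** A) $ i $ j = complex_of_real (l $ i) * A $ i $ j"
proof -
  have "(real_diag l ** A) $ i $ j
      = (\<Sum>k\<in>UNIV. if i = k then complex_of_real (l $ i) * A $ k $ j else 0)"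
    unfolding real_diag_def matrix_matrix_mult_def vec_lambda_beta by (rule sum.cong) auto
  then show ?thesis by simp
qed

lemma mult_real_diag: "(A ** real_diag l) $ i $ j = A $ i $ j * complex_of_real (l $ j)"
proof -
  have "(A ** real_diag l) $ i $ j
      = (\<Sum>k\<in>UNIV. if k = j then A $ i $ k * complex_of_real (l $ k) else 0)"
    unfolding real_diag_def matrix_matrix_mult_def vec_lambda_beta by (rule sum.cong) auto
  then show ?thesis by simp
qed

lemma diagonalization_powr_unique:
  assumes P: "unitary P" and Q: "unitary Q"
    and eq: "P ** real_diag l ** ctranspose P = Q ** real_diag m ** ctranspose Q"
  shows "P ** real_diag (\<chi> i. l $ i powr r) ** ctranspose P
       = Q ** real_diag (\<chi> i. m $ i powr r) ** ctranspose Q"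
proof -
  define W where "W = ctranspose P ** Q"
  define L where "L = real_diag (\<chi> i. l $ i powr r)"
  define M where "M = real_diag (\<chi> i. m $ i powr r)"
  have P': "ctranspose P ** P = mat 1" "P ** ctranspose P = mat 1"
    and Q': "ctranspose Q ** Q = mat 1" "Q ** ctranspose Q = mat 1"
    using P Q by (auto simp: unitary_def)
  have "real_diag l ** W = (ctranspose P ** P) ** real_diag l ** (ctranspose P ** Q)"
    by (simp only: P' W_def matrix_mul_lid)
  also have "\<dots> = ctranspose P ** (P ** real_diag l ** ctranspose P) ** Q"
    by (simp only: matrix_mul_assoc)
  also have "\<dots> = ctranspose P ** (Q ** real_diag m ** ctranspose Q) ** Q"
    by (simp only: eq)
  also have "\<dots> = W ** real_diag m ** (ctranspose Q ** Q)"
    by (simp only: W_def matrix_mul_assoc)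
  also have "\<dots> = W ** real_diag m"
    by (simp only: Q' matrix_mul_rid)
  finally have 1: "real_diag l ** W = W ** real_diag m" .
  have 2: "(L ** W) $ i $ j = (W ** M) $ i $ j" for i j
  proof -
    have "complex_of_real (l $ i) * W $ i $ j = W $ i $ j * complex_of_real (m $ j)"
      using arg_cong[OF 1, of "\<lambda>A. A $ i $ j"] by (simp only: real_diag_mult mult_real_diag)
    then show ?thesis
      by (cases "W $ i $ j = 0") (auto simp: L_def M_def real_diag_mult mult_real_diag)
  qed
  have LW: "L ** W = W ** M"
    using 2 by (simp add: vec_eq_iff)
  have "P ** L ** ctranspose P = P ** L ** ctranspose P ** (Q ** ctranspose Q)"
    by (simp only: Q' matrix_mul_rid)
  also have "\<dots> = P ** (L ** W) ** ctranspose Q"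
    by (simp only: W_def matrix_mul_assoc)
  also have "\<dots> = P ** (W ** M) ** ctranspose Q"
    by (simp only: LW)
  also have "\<dots> = (P ** ctranspose P) ** Q ** M ** ctranspose Q"
    by (simp only: W_def matrix_mul_assoc)
  also have "\<dots> = Q ** M ** ctranspose Q"
    by (simp only: P' matrix_mul_lid)
  finally show ?thesis
    unfolding L_def M_def .
qed

lemma mat_powr_diagonalized:
  assumes "unitary P"
  shows "mat_powr (P ** real_diag l ** ctranspose P) r
       = P ** real_diag (\<chi> i. l $ i powr r) ** ctranspose P"
  unfolding mat_powr_def
proof (rule the_equality)
  show "\<exists>Q m. unitary Q \<and> P ** real_diag l ** ctranspose P = Q ** real_diag m ** ctranspose Q \<and>
    P ** real_diag (\<chi> i. l $ i powr r) ** ctranspose P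
      = Q ** real_diag (\<chi> i. m $ i powr r) ** ctranspose Q"
    by (intro exI[of _ P] exI[of _ l] conjI refl assms)
next
  fix B
  assume "\<exists>Q m. unitary Q \<and> P ** real_diag l ** ctranspose P = Q ** real_diag m ** ctranspose Q \<and>
    B = Q ** real_diag (\<chi> i. m $ i powr r) ** ctranspose Q"
  then obtain Q m where "unitary Q"
    and "P ** real_diag l ** ctranspose P = Q ** real_diag m ** ctranspose Q"
    and B: "B = Q ** real_diag (\<chi> i. m $ i powr r) ** ctranspose Q"
    by (elim exE conjE)
  then show "B = P ** real_diag (\<chi> i. l $ i powr r) ** ctranspose P"
    unfolding B by (intro diagonalization_powr_unique[OF assms, symmetric])
qed

definition op_norm :: "complex^'n^'n \<Rightarrow> real" where
  "op_norm A = onorm (\<lambda>v. A *v v)"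

section \<open>Matrix weights and weighted spaces\<close>

definition matrix_weight :: "(real^'d \<Rightarrow> complex^'n^'n) \<Rightarrow> bool" where
  "matrix_weight U \<longleftrightarrow>
     (\<forall>x. self_adjoint (U x)) \<and>
     (\<forall>i j K. compact K \<longrightarrow> (\<lambda>x. U x $ i $ j) absolutely_integrable_on K) \<and>
     (AE x in lebesgue. pos_def (U x))"

text \<open>Powers with positive exponent on \<open>[0,\<infinity>]\<close>.\<close>

definition ennpowr :: "ennreal \<Rightarrow> real \<Rightarrow> ennreal" where
  "ennpowr a r = (if a = \<infinity> then \<infinity> else ennreal (enn2real a powr r))"

definition Lp_norm :: "real \<Rightarrow> (real^'d \<Rightarrow> complex^'n^'n) \<Rightarrow> (real^'d \<Rightarrow> complex^'n) \<Rightarrow> ennreal" where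
  "Lp_norm p U f =
     ennpowr (\<integral>\<^sup>+ x. ennreal (norm (mat_powr (U x) (1 / p) *v f x) powr p) \<partial>lebesgue) (1 / p)"

definition Lp_space :: "real \<Rightarrow> (real^'d \<Rightarrow> complex^'n^'n) \<Rightarrow> (real^'d \<Rightarrow> complex^'n) set" where
  "Lp_space p U = {f. f \<in> borel_measurable lebesgue \<and> Lp_norm p U f < \<infinity>}"

section \<open>The two-weight \<open>A\<^sub>p\<close> condition\<close>

definition cubes :: "(real^'d) set set" where
  "cubes = {cbox a (a + (\<chi> i. s)) | a s. 0 < s}"

definition nn_avg :: "(real^'d) set \<Rightarrow> (real^'d \<Rightarrow> ennreal) \<Rightarrow> ennreal" where
  "nn_avg Q h = (\<integral>\<^sup>+ x\<in>Q. h x \<partial>lebesgue) / emeasure lebesgue Q"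

definition conj_exp :: "real \<Rightarrow> real" where
  "conj_exp p = p / (p - 1)"

definition Ap_pair :: "real \<Rightarrow> (real^'d \<Rightarrow> complex^'n^'n) \<Rightarrow> (real^'d \<Rightarrow> complex^'n^'n) \<Rightarrow> bool" where
  "Ap_pair p U V \<longleftrightarrow>
     (if p = 1 then
        (SUP Q\<in>cubes. esssup (lebesgue_on Q)
           (\<lambda>y. nn_avg Q (\<lambda>x. ennreal (op_norm (U x ** mat_powr (V y) (- 1)))))) < \<infinity>
      else
        (SUP Q\<in>cubes. ennpowr
           (nn_avg Q (\<lambda>x. ennpowr
              (nn_avg Q (\<lambda>y. ennreal
                 (op_norm (mat_powr (U x) (1 / p) ** mat_powr (V y) (- 1 / p)) powr conj_exp p)))
              (p / conj_exp p)))
           (1 / p)) < \<infinity>)"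

section \<open>Mollifiers\<close>

text \<open>\<open>C\<^sup>k\<close>: differentiable with every directional derivative of class \<open>C\<^sup>k\<^sup>-\<^sup>1\<close>.\<close>

fun Ck :: "nat \<Rightarrow> (real^'d \<Rightarrow> real) \<Rightarrow> bool" where
  "Ck 0 g \<longleftrightarrow> continuous_on UNIV g"
| "Ck (Suc k) g \<longleftrightarrow> (\<forall>x. g differentiable (at x)) \<and>
     (\<forall>v. Ck k (\<lambda>x. frechet_derivative g (at x) v))"

definition Cc_infinity :: "(real^'d) set \<Rightarrow> (real^'d \<Rightarrow> real) set" where
  "Cc_infinity S = {g. (\<forall>k. Ck k g) \<and> compact (closure {x. g x \<noteq> 0}) \<and>
     closure {x. g x \<noteq> 0} \<subseteq> S}"

definition radial :: "(real^'d \<Rightarrow> real) \<Rightarrow> bool" where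
  "radial g \<longleftrightarrow> (\<forall>x y. norm x = norm y \<longrightarrow> g x = g y)"

definition radially_decreasing :: "(real^'d \<Rightarrow> real) \<Rightarrow> bool" where
  "radially_decreasing g \<longleftrightarrow> (\<forall>x y. norm x \<le> norm y \<longrightarrow> g y \<le> g x)"

definition dilate :: "(real^'d \<Rightarrow> real) \<Rightarrow> real \<Rightarrow> real^'d \<Rightarrow> real" where
  "dilate g t x = g (x /\<^sub>R t) / t ^ CARD('d)"

text \<open>
  A divergent Bochner integral has value \<open>0\<close>, so \<open>convolve g f\<close> is the convolution only if
  \<open>convolution_exists g f\<close>.
\<close>

definition convolution_exists :: "(real^'d \<Rightarrow> real) \<Rightarrow> (real^'d \<Rightarrow> complex^'n) \<Rightarrow> bool" where
  "convolution_exists g f \<longleftrightarrow>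
     (\<forall>x i. integrable lebesgue (\<lambda>y. complex_of_real (g (x - y)) * f y $ i))"

definition convolve :: "(real^'d \<Rightarrow> real) \<Rightarrow> (real^'d \<Rightarrow> complex^'n) \<Rightarrow> real^'d \<Rightarrow> complex^'n" where
  "convolve g f x = (\<chi> i. LINT y|lebesgue. complex_of_real (g (x - y)) * f y $ i)"

end

theory Submission
  imports Defs
begin

text \<open>
  Put \<open>k x y = |U(x)^(1/p) V(y)^(-1/p)|\<close> (operator norm) and \<open>g = |V^(1/p) f|\<close>. Then
  \<open>|U(x)^(1/p) f(y)| \<le> k x y * g y\<close>, so everything about \<open>U\<close> and \<open>V\<close> that matters for the
  mollification of \<open>f\<close> is contained in one scalar kernel. The \<open>A\<^sub>p\<close> condition implies that on every
  cube \<open>Q\<close> the integral operator with this kernel, truncated to \<open>Q \<times> Q\<close>, is bounded on \<open>L\<^sup>p(Q)\<close>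
  with norm at most a fixed multiple of \<open>|Q|\<close>. For \<open>p > 1\<close> this is Hoelder's inequality in \<open>y\<close>
  (\<open>cube_averaging_gt_1\<close>), for \<open>p = 1\<close> it is Tonelli's theorem (\<open>cube_averaging_eq_1\<close>).

  This bound at one scale is enough, because \<open>\<phi>\<^sub>t\<close> is at most \<open>\<phi>(0) / t^d\<close> and lives on the ball of
  radius \<open>t\<close>: if \<open>x\<close> lies in the middle third of a cube of side \<open>3t\<close>, then only values of \<open>f\<close> in that
  cube contribute to \<open>\<phi>\<^sub>t * f\<close> at \<open>x\<close>. Integrating the resulting local estimate over all positions of
  the cube gives the uniform bound (\<open>energy_mollify_le\<close>). The bound on a single cube also shows that
  \<open>f\<close> is locally integrable, so that the convolution exists (\<open>integral_norm_cube_finite\<close>).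

  Convergence as \<open>t\<close> tends to \<open>0\<close> follows by density (\<open>energy_mollify_tendsto\<close>). For continuous compactly supported \<open>h\<close>,
  \<open>\<phi>\<^sub>t * h\<close> tends to \<open>h\<close> uniformly inside a fixed ball, on which \<open>|U|\<close> is integrable. To pass to
  general \<open>f\<close> one also needs that \<open>L\<^sup>p(V)\<close> embeds into \<open>L\<^sup>p(U)\<close>. This comes for free: for \<open>h\<close> as above
  it is the limit \<open>t \<longrightarrow> 0\<close> of the uniform bound, and Fatou's lemma extends it to all \<open>f\<close>
  (\<open>energy_embed\<close>).

  Measurability of \<open>U^(1/p)\<close> is obtained by writing it as a pointwise limit of polynomials in \<open>U\<close>. Since
  weights and functions are only Lebesgue measurable, while Tonelli's theorem is applied to Borel
  functions, all objects are first replaced by Borel versions that agree with them almost everywhere.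
\<close>

section \<open>The spectral theorem and powers of positive definite matrices\<close>

definition cinner :: "complex^'n \<Rightarrow> complex^'n \<Rightarrow> complex" where
  "cinner v w = (\<Sum>i\<in>UNIV. cnj (v $ i) * w $ i)"

lemma Re_cinner: "Re (cinner v w) = v \<bullet> w"
  by (simp add: cinner_def inner_vec_def inner_complex_def)

lemma cinner_self: "cinner v v = complex_of_real ((norm v)\<^sup>2)"
proof -
  have "cinner v v = (\<Sum>i\<in>UNIV. complex_of_real ((norm (v $ i))\<^sup>2))"
    unfolding cinner_def by (intro sum.cong refl) (metis complex_norm_square mult.commute)
  also have "\<dots> = complex_of_real ((norm v)\<^sup>2)"
    by (simp add: norm_vec_def L2_set_def sum_nonneg)
  finally show ?thesis .
qed

lemma cinner_commute: "cinner w v = cnj (cinner v w)"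
  by (simp add: cinner_def mult.commute)

lemma cinner_add_right: "cinner v (w + w') = cinner v w + cinner v w'"
  by (simp add: cinner_def ring_distribs sum.distrib)

lemma cinner_scaleR_right: "cinner v (c *\<^sub>R w) = complex_of_real c * cinner v w"
  unfolding cinner_def by (simp add: sum_distrib_left scaleR_conv_of_real[where 'a=complex] algebra_simps)

lemma cinner_scaleR_left: "cinner (c *\<^sub>R v) w = complex_of_real c * cinner v w"
  by (subst (1 2) cinner_commute) (simp add: cinner_scaleR_right)

lemma cinner_matrix: "cinner v (A *v w) = cinner (ctranspose A *v v) w"
proof -
  have "cinner v (A *v w) = (\<Sum>i\<in>UNIV. \<Sum>j\<in>UNIV. cnj (v $ i) * (A $ i $ j * w $ j))"
    by (simp add: cinner_def matrix_vector_mult_def sum_distrib_left)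
  also have "\<dots> = (\<Sum>j\<in>UNIV. \<Sum>i\<in>UNIV. cnj (v $ i) * (A $ i $ j * w $ j))"
    by (rule sum.swap)
  also have "\<dots> = cinner (ctranspose A *v v) w"
    by (simp add: cinner_def matrix_vector_mult_def sum_distrib_right sum_distrib_left ctranspose_def mult_ac)
  finally show ?thesis .
qed

lemma continuous_on_cinner_right [continuous_intros]:
  "continuous_on S f \<Longrightarrow> continuous_on S (\<lambda>x. cinner v (f x))"
  unfolding cinner_def by (intro continuous_intros)

lemma continuous_on_matrix_vector:
  fixes A :: "complex^'n^'m"
  shows "continuous_on S (\<lambda>v. A *v v)"
  unfolding matrix_vector_mult_def by (intro continuous_intros)

lemma matrix_vector_scaleR:
  fixes A :: "complex^'n^'m"
  shows "A *v (c *\<^sub>R v) = c *\<^sub>R (A *v v)"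
  by (simp add: vec_eq_iff matrix_vector_mult_def scaleR_sum_right)

text \<open>
  The vectors \<open>cnj (u i)\<close> with \<open>i \<in> J\<close>, completed by zero rows, form a square matrix with a zero row; such a
  matrix is singular, and any vector in its kernel will do.
\<close>

lemma orthogonal_vector_exists:
  fixes u :: "'n \<Rightarrow> complex^'n"
  assumes "j \<notin> J"
  shows "\<exists>w. w \<noteq> 0 \<and> (\<forall>i\<in>J. cinner (u i) w = 0)"
proof -
  define B :: "complex^'n^'n" where "B = (\<chi> i k. if i \<in> J then cnj (u i $ k) else 0)"
  have "\<not> (\<exists>B'. B' ** B = mat 1)"
  proof
    assume "\<exists>B'. B' ** B = mat 1"
    then obtain B' where "B ** B' = mat 1"
      using matrix_left_right_inverse by metis
    then have "(B ** B') $ j $ j = 1"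
      by (simp add: mat_def)
    then show False
      using assms by (simp add: matrix_matrix_mult_def B_def)
  qed
  then obtain w where w: "w \<noteq> 0" "B *v w = 0"
    unfolding matrix_left_invertible_ker by blast
  have "cinner (u i) w = (B *v w) $ i" if "i \<in> J" for i
    using that by (simp add: cinner_def B_def matrix_vector_mult_def)
  then show ?thesis using w by auto
qed

lemma self_adjoint_inner:
  assumes "self_adjoint A"
  shows "cinner v (A *v w) = cinner (A *v v) w" "v \<bullet> (A *v w) = (A *v v) \<bullet> w"
proof -
  show *: "cinner v (A *v w) = cinner (A *v v) w"
    using assms by (simp add: self_adjoint_def cinner_matrix)
  show "v \<bullet> (A *v w) = (A *v v) \<bullet> w"
    unfolding Re_cinner[symmetric] * ..
qed

text \<open>
  A maximizer \<open>w\<close> of the Rayleigh quotient on \<open>W\<close> is an eigenvector: otherwise the residual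
  \<open>r = A w - m w\<close> is a nonzero direction inside \<open>W\<close> in which the quotient increases to first order. Only
  the real Hilbert space structure matters for this, since \<open>W\<close> is a real subspace and the eigenvalue is real.
\<close>

lemma eigenvector_in_invariant_subspace:
  fixes A :: "complex^'n^'n"
  assumes A: "self_adjoint A" and sub: "subspace W" and closed: "closed W"
    and inv: "\<And>v. v \<in> W \<Longrightarrow> A *v v \<in> W" and nontriv: "w0 \<in> W" "w0 \<noteq> 0"
  obtains w m where "w \<in> W" "norm w = 1" "A *v w = m *\<^sub>R w"
proof -
  let ?S = "W \<inter> sphere 0 1"
  have "compact ?S"
    using closed by (simp add: compact_sphere closed_Int_compact)
  moreover have "(1 / norm w0) *\<^sub>R w0 \<in> ?S"
    using nontriv sub by (auto simp: subspace_scale)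
  moreover have "continuous_on ?S (\<lambda>v. v \<bullet> (A *v v))"
    by (intro continuous_intros continuous_on_matrix_vector)
  ultimately obtain w where w: "w \<in> ?S" and max: "\<And>v. v \<in> ?S \<Longrightarrow> v \<bullet> (A *v v) \<le> w \<bullet> (A *v w)"
    using continuous_attains_sup[of ?S] by blast
  define m where "m = w \<bullet> (A *v w)"
  define r where "r = A *v w - m *\<^sub>R w"
  have [simp]: "norm w = 1" "w \<in> W" using w by auto
  have r: "r \<in> W"
    unfolding r_def using sub inv by (intro subspace_diff subspace_scale) auto
  have pos: "v \<bullet> (A *v v) \<le> m * (norm v)\<^sup>2" if "v \<in> W" for v
  proof (cases "v = 0")
    case False
    have "(1 / norm v) *\<^sub>R v \<in> ?S"
      using that False sub by (auto simp: subspace_scale)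
    from max[OF this] have "(v \<bullet> (A *v v)) / (norm v)\<^sup>2 \<le> m"
      by (simp add: matrix_vector_scaleR m_def power2_eq_square)
    then show ?thesis using False by (simp add: divide_simps)
  qed simp
  define h where "h = m * (norm r)\<^sup>2 - r \<bullet> (A *v r)"
  \<comment> \<open>the quotient at \<open>w + s r\<close> is at most \<open>m\<close>; the first-order term is \<open>2 s |r|\<^sup>2\<close>\<close>
  have main: "2 * s * (norm r)\<^sup>2 \<le> s\<^sup>2 * h" for s :: real
  proof -
    have ww: "w \<bullet> w = 1" by (simp add: dot_square_norm)
    have Aw: "A *v w = r + m *\<^sub>R w" by (simp add: r_def)
    have wr: "w \<bullet> (A *v r) = r \<bullet> r + m * (w \<bullet> r)"
      unfolding self_adjoint_inner(2)[OF A] Aw by (simp add: inner_simps)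
    have "w + s *\<^sub>R r \<in> W"
      using r sub by (intro subspace_add subspace_scale) auto
    from pos[OF this] have "0 \<le> m * (norm (w + s *\<^sub>R r))\<^sup>2 - (w + s *\<^sub>R r) \<bullet> (A *v (w + s *\<^sub>R r))"
      by simp
    also have "\<dots> = m * (1 + 2 * s * (w \<bullet> r) + s\<^sup>2 * (r \<bullet> r))
       - (w \<bullet> r + m + 2 * s * m * (w \<bullet> r) + 2 * s * (r \<bullet> r) - w \<bullet> r + s\<^sup>2 * (r \<bullet> (A *v r)))"
    proof -
      have "w \<bullet> (A *v w) = m" by (simp add: m_def)
      moreover have "r \<bullet> (A *v w) = r \<bullet> r + m * (w \<bullet> r)"
        unfolding Aw by (simp add: inner_simps inner_commute)
      moreover have "(norm (w + s *\<^sub>R r))\<^sup>2 = 1 + 2 * s * (w \<bullet> r) + s\<^sup>2 * (r \<bullet> r)"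
        unfolding power2_norm_eq_inner
        by (simp add: inner_simps ww inner_commute[of r w] power2_eq_square ring_distribs)
      ultimately show ?thesis
        by (simp add: matrix_vector_right_distrib matrix_vector_scaleR inner_simps
          wr inner_commute[of r w] power2_eq_square) (simp add: algebra_simps)
    qed
    finally show ?thesis
      by (simp add: h_def power2_norm_eq_inner algebra_simps)
  qed
  have "r = 0"
  proof (rule ccontr)
    assume "r \<noteq> 0"
    then have n: "(norm r)\<^sup>2 > 0" by simp
    \<comment> \<open>any \<open>s\<close> with \<open>0 < s\<close> and \<open>s h < 2 |r|\<^sup>2\<close> contradicts \<open>main\<close>\<close>
    define s where "s = (norm r)\<^sup>2 / (\<bar>h\<bar> + 1)"
    have s: "s > 0" using n by (simp add: s_def)
    have "s\<^sup>2 * h \<le> s\<^sup>2 * (\<bar>h\<bar> + 1)" by (intro mult_left_mono) auto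
    also have "\<dots> = s * (norm r)\<^sup>2" by (simp add: s_def power2_eq_square)
    finally have "2 * s * (norm r)\<^sup>2 \<le> s * (norm r)\<^sup>2" using main[of s] by simp
    then show False using s n by simp
  qed
  then have "A *v w = m *\<^sub>R w" by (simp add: r_def)
  then show ?thesis using that[of w m] by simp
qed

text \<open>
  Induction on the index set: the orthogonal complement of the eigenvectors found so far is invariant and
  nontrivial as long as an index is missing, so it contains a further eigenvector.
\<close>

lemma orthonormal_eigenvectors:
  fixes A :: "complex^'n^'n" and J :: "'n set"
  assumes A: "self_adjoint A"
  shows "\<exists>u l. (\<forall>i\<in>J. A *v u i = l i *\<^sub>R u i) \<and>
    (\<forall>i\<in>J. \<forall>j\<in>J. cinner (u i) (u j) = (if i = j then 1 else 0))"
proof (induction J rule: finite_induct[OF finite])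
  case 1
  show ?case by simp
next
  case (2 j J)
  then obtain u l where ev: "\<And>i. i \<in> J \<Longrightarrow> A *v u i = l i *\<^sub>R u i"
    and on: "\<And>i k. i \<in> J \<Longrightarrow> k \<in> J \<Longrightarrow> cinner (u i) (u k) = (if i = k then 1 else 0)"
    by blast
  let ?W = "{w. \<forall>i\<in>J. cinner (u i) w = 0}"
  obtain w0 where w0: "w0 \<noteq> 0" and w0': "w0 \<in> ?W"
    using orthogonal_vector_exists[OF 2(2), of u] by auto
  have sub: "subspace ?W"
    by (auto simp: subspace_def cinner_add_right cinner_scaleR_right cinner_def[of _ 0])
  have closed: "closed ?W"
    unfolding Collect_ball_eq by (intro closed_INT ballI closed_Collect_eq continuous_intros)
  have inv: "A *v v \<in> ?W" if "v \<in> ?W" for v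
    using that by (simp add: self_adjoint_inner(1)[OF A] ev cinner_scaleR_left)
  obtain w m where w: "w \<in> ?W" "norm w = 1" "A *v w = m *\<^sub>R w"
    by (rule eigenvector_in_invariant_subspace[OF A sub closed inv w0' w0])
  have w': "cinner w (u i) = 0" if "i \<in> J" for i
    using w(1) that by (subst cinner_commute) simp
  show ?case
    using 2(2) ev on w w' by (intro exI[of _ "u(j := w)"] exI[of _ "l(j := m)"])
      (auto simp: cinner_self[of w])
qed

theorem spectral_theorem:
  fixes A :: "complex^'n^'n"
  assumes "self_adjoint A"
  obtains P l where "unitary P" "A = P ** real_diag l ** ctranspose P"
proof -
  obtain u :: "'n \<Rightarrow> complex^'n" and l where ev: "\<And>i. A *v u i = l i *\<^sub>R u i"
    and on: "\<And>i j. cinner (u i) (u j) = (if i = j then 1 else 0)"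
    using orthonormal_eigenvectors[OF assms, of UNIV] by auto
  define P :: "complex^'n^'n" where "P = (\<chi> i j. u j $ i)"
  define l' where "l' = (\<chi> i. l i)"
  have 1: "ctranspose P ** P = mat 1"
    using on by (simp add: vec_eq_iff matrix_matrix_mult_def ctranspose_def P_def mat_def cinner_def)
  then have 2: "P ** ctranspose P = mat 1"
    using matrix_left_right_inverse by blast
  have "A ** P = P ** real_diag l'"
  proof (simp add: vec_eq_iff mult_real_diag, intro allI)
    fix i j
    have "(A ** P) $ i $ j = (A *v u j) $ i"
      by (simp add: matrix_matrix_mult_def matrix_vector_mult_def P_def)
    then show "(A ** P) $ i $ j = P $ i $ j * complex_of_real (l' $ j)"
      by (simp add: ev P_def l'_def scaleR_conv_of_real[where 'a=complex])
  qed
  then have "A ** (P ** ctranspose P) = P ** real_diag l' ** ctranspose P"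
    by (simp add: matrix_mul_assoc)
  then show ?thesis
    using that[of P l'] 1 2 by (simp add: unitary_def)
qed

lemma real_diag_vector: "(real_diag l *v v) $ i = complex_of_real (l $ i) * v $ i"
proof -
  have "(real_diag l *v v) $ i = (\<Sum>k\<in>UNIV. if i = k then complex_of_real (l $ i) * v $ k else 0)"
    unfolding real_diag_def matrix_vector_mult_def vec_lambda_beta by (rule sum.cong) auto
  then show ?thesis by simp
qed

lemma pos_def_diagonalization:
  fixes A :: "complex^'n^'n"
  assumes "pos_def A"
  obtains P l where "unitary P" "A = P ** real_diag l ** ctranspose P" "\<And>i. 0 < l $ i"
proof -
  obtain P l where P: "unitary P" and A: "A = P ** real_diag l ** ctranspose P"
    using spectral_theorem assms unfolding pos_def_def by metis
  have "0 < l $ i" for i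
  proof -
    let ?v = "P *v axis i 1"
    have PP: "ctranspose P *v ?v = axis i 1"
      using P by (simp add: matrix_vector_mul_assoc unitary_def)
    have D: "real_diag l *v axis i 1 = l $ i *\<^sub>R axis i 1"
      by (simp add: vec_eq_iff real_diag_vector axis_def scaleR_conv_of_real[where 'a=complex])
    have "A *v ?v = P *v (real_diag l *v (ctranspose P *v ?v))"
      by (simp add: A matrix_vector_mul_assoc matrix_mul_assoc)
    also have "\<dots> = l $ i *\<^sub>R ?v"
      unfolding PP D by (rule matrix_vector_scaleR)
    finally have Av: "A *v ?v = l $ i *\<^sub>R ?v" .
    have "?v \<noteq> 0"
    proof
      assume "?v = 0"
      then have "axis i (1::complex) = 0" using PP by simp
      then show False by (simp add: axis_eq_0_iff)
    qed
    then have "0 < Re (cinner ?v (A *v ?v))"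
      using assms by (simp add: pos_def_def cinner_def)
    then have "0 < l $ i * (norm ?v)\<^sup>2"
      by (simp add: Av cinner_scaleR_right cinner_self)
    then show ?thesis by (simp add: zero_less_mult_iff)
  qed
  then show ?thesis using that P A by blast
qed

lemma real_diag_mult_real_diag: "real_diag a ** real_diag b = real_diag (\<chi> i. a $ i * b $ i)"
  by (simp add: vec_eq_iff real_diag_mult) (simp add: real_diag_def)

lemma unitary_conj_mult:
  assumes "unitary P"
  shows "(P ** A ** ctranspose P) ** (P ** B ** ctranspose P) = P ** (A ** B) ** ctranspose P"
proof -
  have "(P ** A ** ctranspose P) ** (P ** B ** ctranspose P)
     = P ** A ** (ctranspose P ** P) ** B ** ctranspose P"
    by (simp only: matrix_mul_assoc)
  also have "ctranspose P ** P = mat 1" using assms by (simp add: unitary_def)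
  finally show ?thesis by (simp only: matrix_mul_rid matrix_mul_assoc)
qed

lemma mat_powr_one:
  assumes "pos_def A" shows "mat_powr A 1 = A"
proof -
  obtain P l where P: "unitary P" and A: "A = P ** real_diag l ** ctranspose P" and l: "\<And>i. 0 < l $ i"
    using pos_def_diagonalization[OF assms] by metis
  have "(\<chi> i. l $ i powr 1) = l" using l by (simp add: vec_eq_iff less_imp_le)
  then show ?thesis using mat_powr_diagonalized[OF P, of l 1] by (simp add: A)
qed

lemma mat_powr_inverse:
  assumes "pos_def A" shows "mat_powr A (- r) ** mat_powr A r = mat 1"
proof -
  obtain P l where P: "unitary P" and A: "A = P ** real_diag l ** ctranspose P" and l: "\<And>i. 0 < l $ i"
    using pos_def_diagonalization[OF assms] by metis
  have "l $ i powr (- r) * l $ i powr r = 1" for i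
    using l[of i] by (simp add: powr_minus)
  then have "real_diag (\<chi> i. l $ i powr (- r)) ** real_diag (\<chi> i. l $ i powr r) = mat 1"
    unfolding real_diag_mult_real_diag by (simp add: vec_eq_iff real_diag_def mat_def)
  then show ?thesis
    using P unfolding A mat_powr_diagonalized[OF P] unitary_conj_mult[OF P] by (simp add: unitary_def)
qed

lemma bounded_linear_matrix_vector:
  fixes A :: "complex^'n^'m"
  shows "bounded_linear (\<lambda>v. A *v v)"
  by (intro linear_conv_bounded_linear[THEN iffD1] linearI matrix_vector_right_distrib matrix_vector_scaleR)

lemma norm_le_op_norm: "norm (A *v v) \<le> op_norm A * norm v"
  unfolding op_norm_def by (rule onorm[OF bounded_linear_matrix_vector])

lemma op_norm_nonneg: "0 \<le> op_norm A"
  unfolding op_norm_def by (rule onorm_pos_le[OF bounded_linear_matrix_vector])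

lemma op_norm_le: "(\<And>v. norm (A *v v) \<le> c * norm v) \<Longrightarrow> op_norm A \<le> c"
  unfolding op_norm_def by (intro onorm_le)

lemma op_norm_le_sum_entries:
  fixes A :: "complex^'n^'n"
  shows "op_norm A \<le> (\<Sum>i\<in>UNIV. \<Sum>j\<in>UNIV. norm (A $ i $ j))"
proof (rule op_norm_le)
  fix v
  have "norm (A *v v) \<le> (\<Sum>i\<in>UNIV. norm ((A *v v) $ i))" unfolding norm_vec_def by (intro L2_set_le_sum) simp
  also have "\<dots> \<le> (\<Sum>i\<in>UNIV. \<Sum>j\<in>UNIV. norm (A $ i $ j) * norm v)"
  proof (rule sum_mono)
    fix i
    have "norm ((A *v v) $ i) \<le> (\<Sum>j\<in>UNIV. norm (A $ i $ j * v $ j))"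
      unfolding matrix_vector_mult_def by (simp add: norm_sum)
    also have "\<dots> \<le> (\<Sum>j\<in>UNIV. norm (A $ i $ j) * norm v)"
      by (intro sum_mono) (simp add: norm_mult mult_left_mono Finite_Cartesian_Product.norm_nth_le)
    finally show "norm ((A *v v) $ i) \<le> (\<Sum>j\<in>UNIV. norm (A $ i $ j) * norm v)" .
  qed
  finally show "norm (A *v v) \<le> (\<Sum>i\<in>UNIV. \<Sum>j\<in>UNIV. norm (A $ i $ j)) * norm v"
    by (simp add: sum_distrib_right)
qed

lemma op_norm_diff_le: "\<bar>op_norm A - op_norm B\<bar> \<le> op_norm (A - B)"
proof -
  have *: "op_norm A \<le> op_norm B + op_norm (A - B)" for A B :: "complex^'a^'a"
  proof (rule op_norm_le)
    fix v
    have "norm (A *v v) = norm (B *v v + (A - B) *v v)" by (simp add: matrix_vector_mult_diff_rdistrib)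
    also have "\<dots> \<le> op_norm B * norm v + op_norm (A - B) * norm v"
      by (intro norm_triangle_le add_mono norm_le_op_norm)
    finally show "norm (A *v v) \<le> (op_norm B + op_norm (A - B)) * norm v" by (simp add: algebra_simps)
  qed
  have "op_norm (B - A) = op_norm (A - B)"
    unfolding op_norm_def by (simp add: matrix_vector_mult_diff_rdistrib norm_minus_commute onorm_def)
  then show ?thesis using *[of A B] *[of B A] by simp
qed

lemma continuous_op_norm: "continuous_on UNIV (op_norm :: complex^'n^'n \<Rightarrow> real)"
proof (rule continuous_at_imp_continuous_on, intro ballI)
  fix A :: "complex^'n^'n"
  let ?s = "\<lambda>B. \<Sum>i\<in>UNIV. \<Sum>j\<in>UNIV. norm ((B - A) $ i $ j)"
  have "?s \<midarrow>A\<rightarrow> (\<Sum>i\<in>(UNIV::'n set). \<Sum>j\<in>(UNIV::'n set). norm ((A - A) $ i $ j))"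
    by (intro tendsto_intros)
  then have s: "?s \<midarrow>A\<rightarrow> 0" by simp
  have "\<forall>B. norm (op_norm B - op_norm A) \<le> ?s B"
    using order_trans[OF op_norm_diff_le op_norm_le_sum_entries, of _ A] by simp
  from Lim_null_comparison[OF always_eventually[OF this] s]
  have "(\<lambda>B. op_norm B - op_norm A) \<midarrow>A\<rightarrow> 0" .
  then show "isCont op_norm A" unfolding isCont_def by (rule LIM_zero_cancel)
qed

lemma norm_unitary:
  assumes "ctranspose P ** P = mat 1" shows "norm (P *v v) = norm v"
proof -
  have "cinner (P *v v) (P *v v) = cinner v v"
    unfolding cinner_matrix by (simp add: matrix_vector_mul_assoc assms)
  then have "(norm (P *v v))\<^sup>2 = (norm v)\<^sup>2" unfolding cinner_self using of_real_eq_iff by blast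
  then show ?thesis by simp
qed

lemma ctranspose_ctranspose [simp]: "ctranspose (ctranspose A) = A"
  by (simp add: ctranspose_def vec_eq_iff)

lemma norm_real_diag_le:
  assumes "\<And>i. \<bar>l $ i\<bar> \<le> c" and "0 \<le> c"
  shows "norm (real_diag l *v v) \<le> c * norm v"
proof -
  have "norm (real_diag l *v v) \<le> L2_set (\<lambda>i. c * norm (v $ i)) UNIV"
    unfolding norm_vec_def using assms by (intro L2_set_mono) (auto simp: real_diag_vector norm_mult intro: mult_right_mono)
  also have "\<dots> = c * norm v"
    unfolding norm_vec_def using assms(2) by (simp add: L2_set_right_distrib)
  finally show ?thesis .
qed

lemma op_norm_diagonalized_le:
  assumes P: "unitary P" and "\<And>i. \<bar>l $ i\<bar> \<le> c" and "0 \<le> c"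
  shows "op_norm (P ** real_diag l ** ctranspose P) \<le> c"
proof (rule op_norm_le)
  fix v
  have "norm ((P ** real_diag l ** ctranspose P) *v v) = norm (P *v (real_diag l *v (ctranspose P *v v)))"
    by (simp add: matrix_vector_mul_assoc matrix_mul_assoc)
  also have "\<dots> = norm (real_diag l *v (ctranspose P *v v))"
    using P by (simp add: norm_unitary unitary_def)
  also have "\<dots> \<le> c * norm (ctranspose P *v v)" by (rule norm_real_diag_le) fact+
  also have "norm (ctranspose P *v v) = norm v"
    using P by (simp add: norm_unitary unitary_def)
  finally show "norm ((P ** real_diag l ** ctranspose P) *v v) \<le> c * norm v" .
qed


text \<open>
  Both sides are determined by the largest eigenvalue. This makes \<open>|U^(1/p)|^p\<close> locally integrable for a
  weight \<open>U\<close>.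
\<close>

lemma op_norm_mat_powr_le:
  assumes "pos_def A" and "0 < r"
  shows "op_norm (mat_powr A r) \<le> op_norm A powr r"
proof -
  obtain P l where P: "unitary P" and A: "A = P ** real_diag l ** ctranspose P" and l: "\<And>i. 0 < l $ i"
    using pos_def_diagonalization[OF assms(1)] by metis
  have "l $ i \<le> op_norm A" for i
  proof -
    let ?e = "axis i 1 :: complex^'a"
    have "real_diag l = ctranspose P ** A ** P"
    proof -
      have "ctranspose P ** A ** P = (ctranspose P ** P) ** real_diag l ** (ctranspose P ** P)"
        by (simp only: A matrix_mul_assoc)
      then show ?thesis using P by (simp add: unitary_def)
    qed
    then have "real_diag l *v ?e = ctranspose P *v (A *v (P *v ?e))"
      by (simp add: matrix_vector_mul_assoc matrix_mul_assoc)
    then have "norm (real_diag l *v ?e) = norm (A *v (P *v ?e))"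
      using P by (simp add: norm_unitary unitary_def)
    also have "\<dots> \<le> op_norm A * norm (P *v ?e)" by (rule norm_le_op_norm)
    also have "norm (P *v ?e) = 1" using P by (simp add: norm_unitary unitary_def norm_axis_1)
    finally have "norm (real_diag l *v ?e) \<le> op_norm A" by simp
    moreover have "norm ((real_diag l *v ?e) $ i) \<le> norm (real_diag l *v ?e)"
      by (rule Finite_Cartesian_Product.norm_nth_le)
    ultimately show ?thesis using l[of i] by (simp add: real_diag_vector axis_def)
  qed
  then show ?thesis
    unfolding A mat_powr_diagonalized[OF P] using l assms(2)
    by (intro op_norm_diagonalized_le[OF P]) (auto intro!: powr_mono2 simp: less_imp_le)
qed

primrec matrix_power :: "complex^'n^'n \<Rightarrow> nat \<Rightarrow> complex^'n^'n" where
  "matrix_power A 0 = mat 1"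
| "matrix_power A (Suc k) = A ** matrix_power A k"

lemma matrix_power_diagonalized:
  assumes P: "unitary P"
  shows "matrix_power (P ** real_diag l ** ctranspose P) k = P ** real_diag (\<chi> i. l $ i ^ k) ** ctranspose P"
proof (induction k)
  case 0
  have "real_diag (\<chi> i::'a. 1) = mat 1" by (simp add: vec_eq_iff real_diag_def mat_def)
  then show ?case using P by (simp add: unitary_def)
next
  case (Suc k)
  show ?case by (simp add: Suc unitary_conj_mult[OF P] real_diag_mult_real_diag)
qed

text \<open>
  Each entry depends linearly on the eigenvalues, so convergence of functions on the spectrum gives convergence
  of the corresponding functions of the matrix.
\<close>

lemma diagonalized_entry:
  "(P ** real_diag l ** ctranspose P) $ i $ j = (\<Sum>k\<in>UNIV. l $ k *\<^sub>R (P $ i $ k * cnj (P $ j $ k)))"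
proof -
  have "(P ** real_diag l ** ctranspose P) $ i $ j = (\<Sum>k\<in>UNIV. (P ** real_diag l) $ i $ k * cnj (P $ j $ k))"
    unfolding matrix_matrix_mult_def[of "P ** real_diag l"] by (simp add: ctranspose_def)
  then show ?thesis
    by (simp add: mult_real_diag scaleR_conv_of_real[where 'a=complex] mult_ac)
qed

lemma continuous_on_matrix_power: "continuous_on S (\<lambda>A. matrix_power A k)"
proof (induction k)
  case (Suc k)
  then show ?case unfolding matrix_power.simps matrix_matrix_mult_def by (intro continuous_intros)
qed simp

text \<open>
  Weierstrass approximation on the intervals \<open>[1/m, m]\<close>, which exhaust the positive half-line. The same
  sequence of polynomials serves for all positive definite matrices.
\<close>

lemma polynomials_tendsto_powr:
  "\<exists>(a :: nat \<Rightarrow> nat \<Rightarrow> real) n. \<forall>x>0. (\<lambda>m. \<Sum>i\<le>n m. a m i * x ^ i) \<longlonglongrightarrow> x powr r"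
proof -
  have "\<exists>a n. \<forall>x\<in>{inverse (real (Suc m))..real (Suc m)}. \<bar>x powr r - (\<Sum>i\<le>n. a i * x ^ i)\<bar> < inverse (real (Suc m))" for m
  proof -
    have "continuous_on {inverse (real (Suc m))..real (Suc m)} (\<lambda>x. x powr r)"
    proof (intro continuous_intros ballI)
      fix x assume "x \<in> {inverse (real (Suc m))..real (Suc m)}"
      moreover have "inverse (real (Suc m)) > 0" by simp
      ultimately show "x \<noteq> 0" by (metis atLeastAtMost_iff less_le_not_le)
    qed
    from Stone_Weierstrass_real_polynomial_function[OF compact_Icc this, of "inverse (real (Suc m))"]
    obtain g where "real_polynomial_function g"
      and g: "\<And>x. x \<in> {inverse (real (Suc m))..real (Suc m)} \<Longrightarrow> \<bar>x powr r - g x\<bar> < inverse (real (Suc m))"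
      by auto
    then obtain a n where "g = (\<lambda>x. \<Sum>i\<le>n. a i * x ^ i)"
      unfolding real_polynomial_function_iff_sum by blast
    then show ?thesis using g by blast
  qed
  then obtain a n where an: "\<And>m x. x \<in> {inverse (real (Suc m))..real (Suc m)} \<Longrightarrow>
      \<bar>x powr r - (\<Sum>i\<le>n m. a m i * x ^ i)\<bar> < inverse (real (Suc m))"
    by metis
  show ?thesis
  proof (intro exI[of _ a] exI[of _ n] allI impI)
    fix x :: real assume x: "0 < x"
    have "\<forall>\<^sub>F m in sequentially. inverse (real (Suc m)) < x"
      using LIMSEQ_inverse_real_of_nat x by (rule order_tendstoD)
    moreover have "\<forall>\<^sub>F m in sequentially. x \<le> real (Suc m)"
      using eventually_ge_at_top[of "nat \<lceil>x\<rceil>"] by eventually_elim linarith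
    ultimately have "\<forall>\<^sub>F m in sequentially. norm ((\<Sum>i\<le>n m. a m i * x ^ i) - x powr r) \<le> inverse (real (Suc m))"
      by eventually_elim (use an[of x] in \<open>auto simp: abs_minus_commute intro!: less_imp_le\<close>)
    from LIM_zero_cancel[OF Lim_null_comparison[OF this LIMSEQ_inverse_real_of_nat]]
    show "(\<lambda>m. \<Sum>i\<le>n m. a m i * x ^ i) \<longlonglongrightarrow> x powr r" .
  qed
qed

lemma borel_measurable_mat_powr:
  fixes F :: "'a \<Rightarrow> complex^'n^'n"
  assumes [measurable]: "F \<in> borel_measurable M" and pos: "\<And>x. pos_def (F x)"
  shows "(\<lambda>x. mat_powr (F x) r) \<in> borel_measurable M"
proof -
  obtain a n where an: "\<And>x. 0 < x \<Longrightarrow> (\<lambda>m. \<Sum>i\<le>n m. a m i * x ^ i) \<longlonglongrightarrow> x powr r"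
    using polynomials_tendsto_powr[of r] by metis
  define Q where "Q m A = (\<Sum>i\<le>n m. a m i *\<^sub>R matrix_power A i)" for m and A :: "complex^'n^'n"
  have "continuous_on UNIV (Q m)" for m
    unfolding Q_def by (intro continuous_intros continuous_on_matrix_power)
  then have "Q m \<in> borel_measurable borel" for m
    by (rule borel_measurable_continuous_onI)
  then have "(\<lambda>x. Q m (F x)) \<in> borel_measurable M" for m by measurable
  moreover have "(\<lambda>m. Q m (F x)) \<longlonglongrightarrow> mat_powr (F x) r" for x
  proof -
    obtain P l where P: "unitary P" and A: "F x = P ** real_diag l ** ctranspose P" and l: "\<And>i. 0 < l $ i"
      using pos_def_diagonalization[OF pos] by metis
    show ?thesis
    proof (intro vec_tendstoI)
      fix i j
      let ?c = "\<lambda>k. P $ i $ k * cnj (P $ j $ k)"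
      have "Q m (F x) $ i $ j = (\<Sum>k\<in>UNIV. (\<Sum>q\<le>n m. a m q * l $ k ^ q) *\<^sub>R ?c k)" for m
        by (simp add: Q_def A matrix_power_diagonalized[OF P] diagonalized_entry scaleR_sum_left
          scaleR_sum_right sum.swap[of _ UNIV])
      moreover have "(\<lambda>m. \<Sum>k\<in>UNIV. (\<Sum>q\<le>n m. a m q * l $ k ^ q) *\<^sub>R ?c k)
          \<longlonglongrightarrow> (\<Sum>k\<in>UNIV. (l $ k powr r) *\<^sub>R ?c k)"
        by (intro tendsto_intros an l)
      ultimately show "(\<lambda>m. Q m (F x) $ i $ j) \<longlonglongrightarrow> mat_powr (F x) r $ i $ j"
        by (simp add: A mat_powr_diagonalized[OF P] diagonalized_entry)
    qed
  qed
  ultimately show ?thesis by (rule borel_measurable_LIMSEQ_metric)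
qed

section \<open>Powers of extended nonnegative reals and Hoelder's inequality\<close>

lemma ennpowr_ennreal: "0 \<le> a \<Longrightarrow> ennpowr (ennreal a) r = ennreal (a powr r)"
  by (simp add: ennpowr_def)

lemma ennpowr_top [simp]: "ennpowr top r = top"
  by (simp add: ennpowr_def)

lemma ennpowr_0 [simp]: "ennpowr 0 r = 0"
  by (simp add: ennpowr_def)

lemma ennpowr_one [simp]: "ennpowr a 1 = a"
  by (cases a) (simp_all add: ennpowr_ennreal)

lemma ennpowr_mono: "a \<le> b \<Longrightarrow> 0 \<le> r \<Longrightarrow> ennpowr a r \<le> ennpowr b r"
  by (cases a; cases b) (auto simp: ennpowr_ennreal top_unique intro!: ennreal_leI powr_mono2)

lemma ennpowr_eq_0_iff [simp]: "ennpowr a r = 0 \<longleftrightarrow> a = 0"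
  by (cases a) (auto simp: ennpowr_ennreal ennreal_eq_0_iff)

lemma ennpowr_eq_top_iff [simp]: "ennpowr a r = top \<longleftrightarrow> a = top"
  by (cases a) (auto simp: ennpowr_ennreal)

lemma ennpowr_less_top_iff [simp]: "ennpowr a r < top \<longleftrightarrow> a < top"
  by (simp add: less_top[symmetric])

lemma ennpowr_mult: "ennpowr (a * b) r = ennpowr a r * ennpowr b r"
proof (cases "a = 0 \<or> b = 0 \<or> a = top \<or> b = top")
  case True
  then show ?thesis by (auto simp: ennreal_top_mult ennreal_mult_top)
next
  case False
  then obtain x y where "a = ennreal x" "b = ennreal y" "0 \<le> x" "0 \<le> y"
    by (cases a; cases b) auto
  then show ?thesis
    by (simp add: ennpowr_ennreal powr_mult flip: ennreal_mult)
qed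

lemma ennpowr_ennpowr: "ennpowr (ennpowr a r) s = ennpowr a (r * s)"
  by (cases a) (simp_all add: ennpowr_ennreal powr_powr)

lemma borel_measurable_ennpowr [measurable (raw)]:
  assumes [measurable]: "f \<in> borel_measurable M"
  shows "(\<lambda>x. ennpowr (f x) r) \<in> borel_measurable M"
  unfolding ennpowr_def by measurable

lemma tendsto_ennpowr_0:
  assumes f: "(f \<longlongrightarrow> 0) F" and r: "0 < r"
  shows "((\<lambda>x. ennpowr (f x) r) \<longlongrightarrow> 0) F"
proof (rule order_tendstoI)
  fix a :: ennreal assume a: "0 < a"
  have "\<forall>\<^sub>F x in F. f x < ennpowr a (1 / r)"
    using f a by (intro order_tendstoD) (auto simp: zero_less_iff_neq_zero)
  then show "\<forall>\<^sub>F x in F. ennpowr (f x) r < a"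
  proof eventually_elim
    fix x assume x: "f x < ennpowr a (1 / r)"
    show "ennpowr (f x) r < a"
    proof (rule ccontr)
      assume "\<not> ennpowr (f x) r < a"
      then have "ennpowr a (1 / r) \<le> ennpowr (ennpowr (f x) r) (1 / r)"
        using r by (intro ennpowr_mono) auto
      then show False using x r by (simp add: ennpowr_ennpowr)
    qed
  qed
qed (auto simp: not_less_zero)

text \<open>
  The inequality is raised to the power \<open>p\<close>, which leaves the integral of \<open>g^p\<close> outside any power; in this
  form it can be integrated further in a parameter on which only \<open>k\<close> depends. The proof applies Young's
  inequality to the functions normalized by their norms.
\<close>

lemma Hoelder_inequality:
  fixes k g :: "'a \<Rightarrow> real"
  assumes p: "1 < p" and [measurable]: "k \<in> borel_measurable M" "g \<in> borel_measurable M"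
    and nonneg: "\<And>x. 0 \<le> k x" "\<And>x. 0 \<le> g x"
  shows "ennpowr (\<integral>\<^sup>+x. ennreal (k x * g x) \<partial>M) p
    \<le> ennpowr (\<integral>\<^sup>+x. ennreal (k x powr conj_exp p) \<partial>M) (p / conj_exp p) * (\<integral>\<^sup>+x. ennreal (g x powr p) \<partial>M)"
proof -
  define q where "q = conj_exp p"
  have q: "q > 1" "1 / p + 1 / q = 1"
    using p by (auto simp: q_def conj_exp_def divide_simps)
  define a where "a = (\<integral>\<^sup>+x. ennreal (k x powr q) \<partial>M)"
  define b where "b = (\<integral>\<^sup>+x. ennreal (g x powr p) \<partial>M)"
  show ?thesis
  proof (cases "a = 0 \<or> b = 0")
    case True
    then have "(AE x in M. ennreal (k x powr q) = 0) \<or> (AE x in M. ennreal (g x powr p) = 0)"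
      unfolding a_def b_def by (subst (asm) (1 2) nn_integral_0_iff_AE) auto
    then have "AE x in M. ennreal (k x * g x) = 0"
      by (auto elim!: eventually_mono simp: ennreal_eq_0_iff)
    then have "(\<integral>\<^sup>+x. ennreal (k x * g x) \<partial>M) = 0"
      by (simp add: nn_integral_0_iff_AE)
    then show ?thesis by simp
  next
    case ab: False
    show ?thesis
    proof (cases "a = top \<or> b = top")
      case True
      then have "ennpowr a (p / q) * b = top"
        using ab by (auto simp: ennreal_top_mult ennreal_mult_top)
      then show ?thesis by (simp add: a_def b_def q_def)
    next
      case False
      with ab obtain \<alpha> \<beta> where \<alpha>: "a = ennreal \<alpha>" "0 < \<alpha>" and \<beta>: "b = ennreal \<beta>" "0 < \<beta>"
        by (cases a; cases b) (auto simp: less_le)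
      define A where "A = \<alpha> powr (1 / q)"
      define B where "B = \<beta> powr (1 / p)"
      have AB: "0 < A" "0 < B" "A powr q = \<alpha>" "B powr p = \<beta>"
        using \<alpha> \<beta> p q by (auto simp: A_def B_def powr_powr)
      have Young: "k x * g x \<le> A * B / (q * \<alpha>) * k x powr q + A * B / (p * \<beta>) * g x powr p" for x
      proof -
        have "k x / A * (g x / B) \<le> (k x / A) powr q / q + (g x / B) powr p / p"
          using p q AB nonneg by (intro Youngs_inequality) auto
        also have "\<dots> = k x powr q / (q * \<alpha>) + g x powr p / (p * \<beta>)"
          using nonneg AB by (simp add: powr_divide mult.commute)
        finally have "A * B * (k x / A * (g x / B)) \<le> A * B * (k x powr q / (q * \<alpha>) + g x powr p / (p * \<beta>))"
          using AB by (intro mult_left_mono) auto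
        then show ?thesis using AB by (simp add: field_simps)
      qed
      have "(\<integral>\<^sup>+x. ennreal (k x * g x) \<partial>M)
          \<le> (\<integral>\<^sup>+x. ennreal (A * B / (q * \<alpha>)) * ennreal (k x powr q) + ennreal (A * B / (p * \<beta>)) * ennreal (g x powr p) \<partial>M)"
        using Young AB \<alpha> \<beta> p q by (intro nn_integral_mono) (simp flip: ennreal_mult ennreal_plus)
      also have "\<dots> = ennreal (A * B / (q * \<alpha>)) * a + ennreal (A * B / (p * \<beta>)) * b"
        unfolding a_def b_def by (simp add: nn_integral_add nn_integral_cmult)
      also have "\<dots> = ennreal (A * B * (1 / p + 1 / q))"
        using \<alpha> \<beta> AB p q unfolding \<alpha> \<beta>
        by (simp add: field_simps flip: ennreal_mult ennreal_plus)
      also have "\<dots> = ennreal (A * B)" by (simp add: q)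
      finally have "ennpowr (\<integral>\<^sup>+x. ennreal (k x * g x) \<partial>M) p \<le> ennpowr (ennreal (A * B)) p"
        using p by (intro ennpowr_mono) auto
      also have "\<dots> = ennpowr a (p / q) * b"
        using AB \<alpha> \<beta> p by (simp add: ennpowr_ennreal powr_mult A_def powr_powr flip: ennreal_mult)
      finally show ?thesis by (simp add: a_def b_def q_def)
    qed
  qed
qed

section \<open>Cubes and dilations\<close>

abbreviation cube :: "real^'d \<Rightarrow> real \<Rightarrow> (real^'d) set" where
  "cube a s \<equiv> cbox a (a + (\<chi> i. s))"

lemma emeasure_cube:
  fixes a :: "real^'d"
  assumes "0 \<le> s"
  shows "emeasure lborel (cube a s) = ennreal (s ^ CARD('d))"
proof -
  have "cube a s \<noteq> {}" using assms by (simp add: interval_ne_empty_cart)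
  then have "measure lborel (cube a s) = s ^ CARD('d)"
    using content_cbox_cart[of a "a + (\<chi> i. s)"] by simp
  moreover have "emeasure lborel (cube a s) = ennreal (measure lborel (cube a s))"
    using emeasure_lborel_cbox_finite[of a "a + (\<chi> i. s)"]
    by (intro emeasure_eq_ennreal_measure) (simp add: less_top)
  ultimately show ?thesis by simp
qed

lemma mem_cube_iff: "x \<in> cube a s \<longleftrightarrow> (\<forall>i. a $ i \<le> x $ i \<and> x $ i \<le> a $ i + s)"
  by (simp add: mem_box_cart)

text \<open>
  Averaging over the position of a cube replaces a partition of space into cubes: no overlap has to be counted,
  because each point is covered by a set of positions of the same measure \<open>s^d\<close>.
\<close>

lemma nn_integral_sweep_cubes:
  fixes F :: "real^'d \<Rightarrow> ennreal"
  assumes [measurable]: "F \<in> borel_measurable borel" and s: "0 \<le> s"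
  shows "(\<integral>\<^sup>+a. (\<integral>\<^sup>+x. F x * indicator (cube (a + b) s) x \<partial>lborel) \<partial>lborel)
    = ennreal (s ^ CARD('d)) * (\<integral>\<^sup>+x. F x \<partial>lborel)"
proof -
  have 1: "indicator (cube (a + b) s) x = (indicator (cube 0 s) (x - a - b) :: ennreal)" for a x
    by (auto simp: indicator_def mem_box_cart le_diff_eq diff_le_eq add_ac)
  have 2: "indicator (cube 0 s) (x - a - b) = (indicator (cube (x - b - (\<chi> i. s)) s) a :: ennreal)" for a x
    by (auto simp: indicator_def mem_box_cart le_diff_eq diff_le_eq add_ac)
  have "(\<integral>\<^sup>+a. (\<integral>\<^sup>+x. F x * indicator (cube (a + b) s) x \<partial>lborel) \<partial>lborel)
      = (\<integral>\<^sup>+a. (\<integral>\<^sup>+x. F x * indicator (cube 0 s) (x - a - b) \<partial>lborel) \<partial>lborel)"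
    unfolding 1 ..
  also have "\<dots> = (\<integral>\<^sup>+x. (\<integral>\<^sup>+a. F x * indicator (cube 0 s) (x - a - b) \<partial>lborel) \<partial>lborel)"
    by (rule lborel_pair.Fubini') measurable
  also have "\<dots> = (\<integral>\<^sup>+x. F x * ennreal (s ^ CARD('d)) \<partial>lborel)"
  proof -
    have "emeasure lborel (cbox (x - b - (\<chi> i. s)) (x - b)) = ennreal (s ^ CARD('d))" for x
      using emeasure_cube[OF s, of "x - b - (\<chi> i. s)"] by simp
    then show ?thesis unfolding 2 by (simp add: nn_integral_cmult_indicator)
  qed
  also have "\<dots> = ennreal (s ^ CARD('d)) * (\<integral>\<^sup>+x. F x \<partial>lborel)"
    by (subst nn_integral_multc) (simp_all add: mult.commute)
  finally show ?thesis .
qed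

lemma powr_add_le:
  fixes a b p :: real
  assumes "0 \<le> a" "0 \<le> b" "0 \<le> p"
  shows "(a + b) powr p \<le> 2 powr p * (a powr p + b powr p)"
proof -
  have "(a + b) powr p \<le> (2 * max a b) powr p"
    using assms by (intro powr_mono2) auto
  also have "\<dots> = 2 powr p * max a b powr p" using assms by (simp add: powr_mult)
  also have "\<dots> \<le> 2 powr p * (a powr p + b powr p)"
    by (intro mult_left_mono) (auto simp: max_def)
  finally show ?thesis .
qed

lemma integral_reflected_dilation:
  fixes g :: "real^'d \<Rightarrow> real"
  assumes t: "0 < t" and int: "integrable lborel g"
  shows "has_bochner_integral lborel (\<lambda>y. dilate g t (x - y)) (integral\<^sup>L lborel g)"
proof -
  have [measurable]: "g \<in> borel_measurable borel" using int by auto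
  have *: "lborel = density (distr lborel borel (\<lambda>y. x + (-t) *\<^sub>R y)) (\<lambda>_. ennreal (t ^ CARD('d)))"
    using lborel_affine[of "-t" x] t by (simp add: power_abs)
  have eq: "t ^ CARD('d) *\<^sub>R dilate g t (x - (x + (-t) *\<^sub>R y)) = g y" for y
    using t by (simp add: dilate_def)
  have [measurable]: "(\<lambda>y. dilate g t (x - y)) \<in> borel_measurable borel"
    unfolding dilate_def by measurable
  have "integrable lborel (\<lambda>y. dilate g t (x - y))"
    by (subst *, subst integrable_density)
       (use t eq int in \<open>auto simp: integrable_distr_eq simp del: real_scaleR_def\<close>)
  moreover have "integral\<^sup>L lborel (\<lambda>y. dilate g t (x - y)) = integral\<^sup>L lborel g"
    by (subst *, subst integral_density)
       (use t eq in \<open>auto simp: integral_distr simp del: real_scaleR_def integral_scaleR_right\<close>)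
  ultimately show ?thesis by (simp add: has_bochner_integral_iff)
qed

section \<open>Weighted integrals and density of continuous functions\<close>

lemma borel_measurable_matrix_vector [measurable (raw)]:
  fixes F :: "'a \<Rightarrow> complex^'n^'m"
  assumes "F \<in> borel_measurable M" "f \<in> borel_measurable M"
  shows "(\<lambda>x. F x *v f x) \<in> borel_measurable M"
proof (rule borel_measurable_continuous_Pair[OF assms])
  show "continuous_on UNIV (\<lambda>x :: (complex^'n^'m) \<times> (complex^'n). fst x *v snd x)"
    unfolding matrix_vector_mult_def by (intro continuous_intros)
qed

lemma borel_measurable_op_norm [measurable (raw)]:
  "F \<in> borel_measurable M \<Longrightarrow> (\<lambda>x. op_norm (F x)) \<in> borel_measurable M"
  using borel_measurable_continuous_onI[OF continuous_op_norm] by measurable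

lemma cball_borel [measurable]: "cball (a :: 'a :: metric_space) r \<in> sets borel"
  by (rule borel_closed[OF closed_cball])

text \<open>
  The \<open>p\<close>-th power of the weighted norm, with \<open>M\<close> in the role of the \<open>p\<close>-th root of the weight. Without the
  outer root, limits and sums can be handled directly by the convergence theorems for integrals.
\<close>

definition energy :: "real \<Rightarrow> (real^'d \<Rightarrow> complex^'n^'n) \<Rightarrow> (real^'d \<Rightarrow> complex^'n) \<Rightarrow> ennreal" where
  "energy p M f = (\<integral>\<^sup>+ x. ennreal (norm (M x *v f x) powr p) \<partial>lborel)"

text \<open>
  A quasi-triangle inequality is all that the approximation arguments need.
\<close>

lemma energy_add_le:
  assumes [measurable]: "M \<in> borel_measurable borel" "f \<in> borel_measurable borel" "g \<in> borel_measurable borel"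
    and p: "0 \<le> p"
  shows "energy p M (\<lambda>x. f x + g x) \<le> ennreal (2 powr p) * (energy p M f + energy p M g)"
proof -
  have "norm (M x *v (f x + g x)) powr p \<le> 2 powr p * (norm (M x *v f x) powr p + norm (M x *v g x) powr p)" for x
  proof -
    have "norm (M x *v (f x + g x)) powr p \<le> (norm (M x *v f x) + norm (M x *v g x)) powr p"
      using p by (intro powr_mono2) (auto simp: matrix_vector_right_distrib norm_triangle_ineq)
    also have "\<dots> \<le> 2 powr p * (norm (M x *v f x) powr p + norm (M x *v g x) powr p)"
      using p by (intro powr_add_le) auto
    finally show ?thesis .
  qed
  then have "energy p M (\<lambda>x. f x + g x) \<le> (\<integral>\<^sup>+x. ennreal (2 powr p) *
      (ennreal (norm (M x *v f x) powr p) + ennreal (norm (M x *v g x) powr p)) \<partial>lborel)"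
    unfolding energy_def by (intro nn_integral_mono) (simp flip: ennreal_mult ennreal_plus)
  also have "\<dots> = ennreal (2 powr p) * (energy p M f + energy p M g)"
    unfolding energy_def by (simp add: nn_integral_cmult nn_integral_add)
  finally show ?thesis .
qed

lemma energy_minus_commute:
  fixes f g :: "real^'d \<Rightarrow> complex^'n"
  shows "energy p M (\<lambda>x. f x - g x) = energy p M (\<lambda>x. g x - f x)"
  unfolding energy_def by (simp add: matrix_vector_mult_diff_distrib norm_minus_commute)

lemma tendsto_ennreal_0I:
  fixes f :: "'a \<Rightarrow> ennreal"
  assumes c: "c < top" and ev: "\<And>\<epsilon>. 0 < \<epsilon> \<Longrightarrow> \<forall>\<^sub>F x in F. f x \<le> ennreal \<epsilon> * c"
  shows "(f \<longlongrightarrow> 0) F"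
proof (rule order_tendstoI)
  fix e :: ennreal assume e: "0 < e"
  obtain C where C: "c = ennreal C" "0 \<le> C" using c by (cases c) auto
  have "\<exists>\<epsilon>>0. ennreal \<epsilon> * c < e"
  proof (cases e)
    case (real r)
    then have r: "0 < r" using e by auto
    have "r / (2 * (C + 1)) * C < r"
      using r C(2) by (simp add: divide_simps)
    then show ?thesis
      using r C real by (intro exI[of _ "r / (2 * (C + 1))"]) (auto simp: ennreal_lessI simp flip: ennreal_mult)
  next
    case top
    then show ?thesis using C by (intro exI[of _ 1]) (auto simp: less_top[symmetric])
  qed
  then obtain \<epsilon> where \<epsilon>: "0 < \<epsilon>" "ennreal \<epsilon> * c < e" by blast
  from ev[OF \<epsilon>(1)] show "\<forall>\<^sub>F x in F. f x < e"
    by eventually_elim (use \<epsilon>(2) in auto)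
qed (auto simp: not_less_zero)

text \<open>
  Truncation in the range (\<open>clamp_norm\<close>) and in the domain (\<open>cutoff\<close>). Both factors are continuous, so that
  truncation preserves continuity, and both lie in \<open>[0, 1]\<close>, so that it does not increase any weighted norm.
\<close>

definition clamp_norm :: "real \<Rightarrow> 'a::real_normed_vector \<Rightarrow> 'a" where
  "clamp_norm m v = (m / max m (norm v)) *\<^sub>R v"

definition cutoff :: "real \<Rightarrow> 'a::real_normed_vector \<Rightarrow> real" where
  "cutoff m x = max 0 (min 1 (m - norm x))"

definition truncate :: "real \<Rightarrow> ('a::real_normed_vector \<Rightarrow> 'b::real_normed_vector) \<Rightarrow> 'a \<Rightarrow> 'b" where
  "truncate m f x = cutoff m x *\<^sub>R clamp_norm m (f x)"

lemma continuous_on_truncate: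
  assumes "continuous_on UNIV f" "0 < m" shows "continuous_on UNIV (truncate m f)"
  unfolding truncate_def cutoff_def clamp_norm_def using assms
  by (intro continuous_intros) (auto simp: max_def)

lemma truncate_eq_scaleR:
  assumes "0 < m" obtains c where "0 \<le> c" "c \<le> 1" "truncate m f x = c *\<^sub>R f x"
proof (rule that[of "cutoff m x * (m / max m (norm (f x)))"])
  have "m / max m (norm (f x)) \<le> 1" "0 \<le> m / max m (norm (f x))"
    using assms by (auto simp: divide_simps max_def)
  moreover have "0 \<le> cutoff m x" "cutoff m x \<le> 1" by (auto simp: cutoff_def)
  ultimately show "cutoff m x * (m / max m (norm (f x))) \<le> 1" "0 \<le> cutoff m x * (m / max m (norm (f x)))"
    by (intro mult_le_one mult_nonneg_nonneg; simp)+
qed (simp add: truncate_def clamp_norm_def)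

lemma truncate_outside: "m \<le> norm x \<Longrightarrow> truncate m f x = 0"
  by (simp add: truncate_def cutoff_def)

lemma norm_truncate_le:
  assumes "0 < m" shows "norm (truncate m f x) \<le> m"
proof -
  have "norm (clamp_norm m (f x)) \<le> m"
    using assms by (auto simp: clamp_norm_def divide_simps max_def)
  moreover have "0 \<le> cutoff m x" "cutoff m x \<le> 1" by (auto simp: cutoff_def)
  ultimately show ?thesis
    unfolding truncate_def using mult_left_le_one_le[of "norm (clamp_norm m (f x))" "cutoff m x"] by simp
qed

lemma truncate_eventually_eq: "\<forall>\<^sub>F m in sequentially. truncate (real (Suc m)) f x = f x"
  using eventually_ge_at_top[of "nat \<lceil>norm x + 1\<rceil>"] eventually_ge_at_top[of "nat \<lceil>norm (f x)\<rceil>"]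
proof eventually_elim
  fix m :: nat assume "m \<ge> nat \<lceil>norm x + 1\<rceil>" "m \<ge> nat \<lceil>norm (f x)\<rceil>"
  then have "norm x + 1 \<le> real (Suc m)" "norm (f x) \<le> real (Suc m)" by linarith+
  then show "truncate (real (Suc m)) f x = f x"
    by (simp add: truncate_def cutoff_def clamp_norm_def max_def)
qed

lemma tendsto_truncate:
  assumes "(\<lambda>n. g n x) \<longlonglongrightarrow> f x" "0 < m"
  shows "(\<lambda>n. truncate m (g n) x) \<longlonglongrightarrow> truncate m f x"
  unfolding truncate_def clamp_norm_def using assms
  by (intro tendsto_intros) (auto simp: max_def)

lemma energy_bounded_support_finite:
  fixes M :: "real^'d \<Rightarrow> complex^'n^'n"
  assumes [measurable]: "M \<in> borel_measurable borel" and p: "0 \<le> p" and m: "0 \<le> m"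
    and loc: "(\<integral>\<^sup>+x. ennreal (op_norm (M x) powr p) * indicator (cball 0 r) x \<partial>lborel) < top"
  shows "(\<integral>\<^sup>+x. ennreal ((op_norm (M x) * m * indicator (cball 0 r) x) powr p) \<partial>lborel) < top"
proof -
  have "(\<integral>\<^sup>+x. ennreal ((op_norm (M x) * m * indicator (cball 0 r) x) powr p) \<partial>lborel)
     = (\<integral>\<^sup>+x. ennreal (m powr p) * (ennreal (op_norm (M x) powr p) * indicator (cball 0 r) x) \<partial>lborel)"
    using p m op_norm_nonneg
    by (intro nn_integral_cong) (auto simp: indicator_def powr_mult mult.commute simp flip: ennreal_mult)
  also have "\<dots> = ennreal (m powr p) * (\<integral>\<^sup>+x. ennreal (op_norm (M x) powr p) * indicator (cball 0 r) x \<partial>lborel)"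
    by (rule nn_integral_cmult) measurable
  finally show ?thesis using loc by (simp add: ennreal_mult_less_top)
qed

text \<open>
  Density of continuous compactly supported functions, as an induction principle: a property that holds for
  them and is inherited by dominated limits holds on the whole weighted space. Two limits are taken. A truncated
  function is the limit of truncations of continuous functions that approximate \<open>f\<close> almost everywhere, dominated
  because \<open>|S|^p\<close> is locally integrable; and \<open>f\<close> is the limit of its truncations, dominated by itself.
\<close>

lemma weighted_Lp_induct [consumes 5, case_names continuous limit]:
  fixes S :: "real^'d \<Rightarrow> complex^'n^'n"
  assumes S [measurable]: "S \<in> borel_measurable borel" and p: "0 \<le> p"
    and loc: "\<And>r. (\<integral>\<^sup>+x. ennreal (op_norm (S x) powr p) * indicator (cball 0 r) x \<partial>lborel) < top"
    and f [measurable]: "f \<in> borel_measurable borel" and fin: "energy p S f < top"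
    and cont: "\<And>h r. continuous_on UNIV h \<Longrightarrow> (\<And>x. r < norm x \<Longrightarrow> h x = 0) \<Longrightarrow> P h"
    and lim: "\<And>f F G. f \<in> borel_measurable borel \<Longrightarrow> (\<And>n::nat. F n \<in> borel_measurable borel) \<Longrightarrow>
      G \<in> borel_measurable borel \<Longrightarrow> (\<And>n. P (F n)) \<Longrightarrow> (AE x in lborel. (\<lambda>n. F n x) \<longlonglongrightarrow> f x) \<Longrightarrow>
      (\<And>n x. norm (S x *v F n x) \<le> G x) \<Longrightarrow> (\<integral>\<^sup>+x. ennreal (G x powr p) \<partial>lborel) < top \<Longrightarrow> P f"
  shows "P f"
proof -
  have trunc_meas: "truncate m f \<in> borel_measurable borel" for m
    unfolding truncate_def cutoff_def clamp_norm_def by measurable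
  have "f \<in> borel_measurable lebesgue" by (simp add: measurable_completion)
  then have "f measurable_on UNIV"
    by (simp add: lebesgue_measurable_imp_measurable_on)
  then obtain N g where N: "negligible N" and g: "\<And>n. continuous_on UNIV (g n :: real^'d \<Rightarrow> complex^'n)"
    and gf: "\<And>x. x \<notin> N \<Longrightarrow> (\<lambda>n. g n x) \<longlonglongrightarrow> f x"
    unfolding measurable_on_def by auto
  have "AE x in lebesgue. x \<notin> N"
    using N by (simp add: AE_not_in negligible_iff_null_sets)
  then have gf: "AE x in lborel. (\<lambda>n. g n x) \<longlonglongrightarrow> f x"
    unfolding AE_completion_iff by eventually_elim (rule gf)
  have "P (truncate m f)" if m: "0 < m" for m :: real
  proof (rule lim[where F = "\<lambda>n. truncate m (g n)" and G = "\<lambda>x. op_norm (S x) * m * indicator (cball 0 m) x"])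
    fix n
    show "truncate m (g n) \<in> borel_measurable borel"
      by (intro borel_measurable_continuous_onI continuous_on_truncate g m)
    show "P (truncate m (g n))"
      by (rule cont[where r = m]) (auto intro: continuous_on_truncate g m truncate_outside)
    fix x
    have "norm (S x *v truncate m (g n) x) \<le> op_norm (S x) * norm (truncate m (g n) x)"
      by (rule norm_le_op_norm)
    also have "\<dots> \<le> op_norm (S x) * (m * indicator (cball 0 m) x)"
      using norm_truncate_le[OF m, of "g n" x] truncate_outside[of m x "g n"]
      by (intro mult_left_mono op_norm_nonneg) (auto simp: indicator_def)
    finally show "norm (S x *v truncate m (g n) x) \<le> op_norm (S x) * m * indicator (cball 0 m) x"
      by (simp add: mult.assoc)
  next
    show "AE x in lborel. (\<lambda>n. truncate m (g n) x) \<longlonglongrightarrow> truncate m f x"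
      using gf by eventually_elim (rule tendsto_truncate[OF _ m])
    show "(\<integral>\<^sup>+x. ennreal ((op_norm (S x) * m * indicator (cball 0 m) x) powr p) \<partial>lborel) < top"
      using m p loc by (intro energy_bounded_support_finite S) auto
  qed (use trunc_meas in auto)
  then have "P (truncate (real (Suc m)) f)" for m by simp
  then show ?thesis
  proof (rule lim[where F = "\<lambda>n. truncate (real (Suc n)) f" and G = "\<lambda>x. norm (S x *v f x)", rotated 3])
    show "AE x in lborel. (\<lambda>n. truncate (real (Suc n)) f x) \<longlonglongrightarrow> f x"
      by (intro AE_I2 tendsto_eventually truncate_eventually_eq)
    fix n :: nat and x
    have "0 < real (Suc n)" by simp
    then obtain c where "0 \<le> c" "c \<le> 1" "truncate (real (Suc n)) f x = c *\<^sub>R f x"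
      by (rule truncate_eq_scaleR)
    then show "norm (S x *v truncate (real (Suc n)) f x) \<le> norm (S x *v f x)"
      by (simp add: matrix_vector_scaleR mult_left_le_one_le)
  qed (use trunc_meas fin in \<open>auto simp: energy_def\<close>)
qed

lemma energy_dominated_convergence:
  fixes S :: "real^'d \<Rightarrow> complex^'n^'n"
  assumes [measurable]: "S \<in> borel_measurable borel" and p: "0 < p"
    and [measurable]: "f \<in> borel_measurable borel" "\<And>n. F n \<in> borel_measurable borel" "G \<in> borel_measurable borel"
    and conv: "AE x in lborel. (\<lambda>n. F n x) \<longlonglongrightarrow> f x"
    and dom: "\<And>n x. norm (S x *v F n x) \<le> G x"
    and fin: "(\<integral>\<^sup>+x. ennreal (G x powr p) \<partial>lborel) < top"
  shows "(\<lambda>n. energy p S (F n)) \<longlonglongrightarrow> energy p S f"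
    and "(\<lambda>n. energy p S (\<lambda>x. F n x - f x)) \<longlonglongrightarrow> 0"
proof -
  have cont: "(\<lambda>n. ennreal (norm (S x *v u n) powr p)) \<longlonglongrightarrow> ennreal (norm (S x *v v) powr p)"
    if "u \<longlonglongrightarrow> v" for u v x
  proof -
    have "(\<lambda>n. S x *v u n) \<longlonglongrightarrow> S x *v v"
      by (rule bounded_linear.tendsto[OF bounded_linear_matrix_vector that])
    then show ?thesis
      using p by (intro tendsto_intros tendsto_powr') auto
  qed
  show "(\<lambda>n. energy p S (F n)) \<longlonglongrightarrow> energy p S f"
    unfolding energy_def
  proof (rule nn_integral_dominated_convergence[where w = "\<lambda>x. ennreal (G x powr p)"])
    show "AE x in lborel. ennreal (norm (S x *v F n x) powr p) \<le> ennreal (G x powr p)" for n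
      using dom p by (intro AE_I2 ennreal_leI powr_mono2) auto
    show "AE x in lborel. (\<lambda>n. ennreal (norm (S x *v F n x) powr p)) \<longlonglongrightarrow> ennreal (norm (S x *v f x) powr p)"
      using conv by eventually_elim (rule cont)
  qed (use fin in auto)
  have "(\<lambda>n. energy p S (\<lambda>x. F n x - f x)) \<longlonglongrightarrow> (\<integral>\<^sup>+x. 0 \<partial>(lborel :: (real^'d) measure))"
    unfolding energy_def
  proof (rule nn_integral_dominated_convergence[where w = "\<lambda>x. ennreal (2 powr p) * ennreal (G x powr p)"])
    show "AE x in lborel. ennreal (norm (S x *v (F n x - f x)) powr p) \<le> ennreal (2 powr p) * ennreal (G x powr p)" for n
      using conv
    proof eventually_elim
      fix x assume x: "(\<lambda>n. F n x) \<longlonglongrightarrow> f x"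
      have "(\<lambda>n. norm (S x *v F n x)) \<longlonglongrightarrow> norm (S x *v f x)"
        by (intro tendsto_norm bounded_linear.tendsto[OF bounded_linear_matrix_vector x])
      then have "norm (S x *v f x) \<le> G x"
        by (rule LIMSEQ_le_const2) (use dom in auto)
      then have "norm (S x *v (F n x - f x)) \<le> 2 * G x"
        using dom[of x n] norm_triangle_ineq4[of "S x *v F n x" "S x *v f x"]
        by (simp add: matrix_vector_mult_diff_distrib)
      moreover have "0 \<le> G x" using dom[of x 0] norm_ge_zero order_trans by blast
      ultimately have "norm (S x *v (F n x - f x)) powr p \<le> 2 powr p * G x powr p"
        using p by (simp flip: powr_mult add: powr_mono2)
      then show "ennreal (norm (S x *v (F n x - f x)) powr p) \<le> ennreal (2 powr p) * ennreal (G x powr p)"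
        by (simp flip: ennreal_mult)
    qed
    show "AE x in lborel. (\<lambda>n. ennreal (norm (S x *v (F n x - f x)) powr p)) \<longlonglongrightarrow> 0"
      using conv
    proof eventually_elim
      fix x assume x: "(\<lambda>n. F n x) \<longlonglongrightarrow> f x"
      have "(\<lambda>n. F n x - f x) \<longlonglongrightarrow> 0" using x by (simp add: LIM_zero)
      from cont[OF this, of x] show "(\<lambda>n. ennreal (norm (S x *v (F n x - f x)) powr p)) \<longlonglongrightarrow> 0"
        using p by simp
    qed
  qed (use fin in \<open>auto simp: nn_integral_cmult ennreal_mult_less_top\<close>)
  then show "(\<lambda>n. energy p S (\<lambda>x. F n x - f x)) \<longlonglongrightarrow> 0" by simp
qed

section \<open>Mollification under a kernel bound on cubes\<close>

text \<open>
  For every cube \<open>Q\<close>, the integral operator with kernel \<open>k\<close> truncated to \<open>Q \<times> Q\<close> has norm at most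
  \<open>K^(1/p) |Q|\<close> on \<open>L\<^sup>p(Q)\<close>.
\<close>

definition cube_averaging :: "real \<Rightarrow> real \<Rightarrow> (real^'d \<Rightarrow> real^'d \<Rightarrow> real) \<Rightarrow> bool" where
  "cube_averaging p K k \<longleftrightarrow> (\<forall>a s g. 0 < s \<longrightarrow> g \<in> borel_measurable borel \<longrightarrow> (\<forall>y. 0 \<le> g y) \<longrightarrow>
      (\<integral>\<^sup>+x. ennpowr (\<integral>\<^sup>+y. ennreal (k x y * g y) * indicator (cube a s) y \<partial>lborel) p
          * indicator (cube a s) x \<partial>lborel)
      \<le> ennreal (K * (s ^ CARD('d)) powr p) * (\<integral>\<^sup>+y. ennreal (g y powr p) * indicator (cube a s) y \<partial>lborel))"

text \<open>
  \<open>W\<close> and \<open>S\<close> stand for the \<open>p\<close>-th roots of the target and the source weight. The kernel \<open>k\<close> is the only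
  link between them: it bounds \<open>|W(x) v|\<close> by \<open>|S(y) v|\<close>, and the \<open>A\<^sub>p\<close> condition enters only through the bound on cubes.
\<close>

locale weight_pair =
  fixes W S :: "real^'d \<Rightarrow> complex^'n^'n" and k :: "real^'d \<Rightarrow> real^'d \<Rightarrow> real" and p K :: real
  assumes p: "1 \<le> p" and K: "0 \<le> K"
    and W_borel [measurable]: "W \<in> borel_measurable borel"
    and S_borel [measurable]: "S \<in> borel_measurable borel"
    and k_borel: "(\<lambda>(x, y). k x y) \<in> borel_measurable (borel \<Otimes>\<^sub>M borel)"
    and k_dominates: "\<And>x y v. norm (W x *v v) \<le> k x y * norm (S y *v v)"
    and k_nonneg: "\<And>x y. 0 \<le> k x y"
    and W_injective: "\<And>x. \<exists>c. \<forall>v. norm v \<le> c * norm (W x *v v)"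
    and W_loc: "\<And>r. (\<integral>\<^sup>+x. ennreal (op_norm (W x) powr p) * indicator (cball 0 r) x \<partial>lborel) < top"
    and S_loc: "\<And>r. (\<integral>\<^sup>+x. ennreal (op_norm (S x) powr p) * indicator (cball 0 r) x \<partial>lborel) < top"
    and cube_averaging: "cube_averaging p K k"
begin

lemmas averaging = cube_averaging[unfolded cube_averaging_def, rule_format]

lemma k_borel' [measurable (raw)]:
  "f \<in> borel_measurable M \<Longrightarrow> g \<in> borel_measurable M \<Longrightarrow> (\<lambda>z. k (f z) (g z)) \<in> borel_measurable M"
  using measurable_compose[OF measurable_Pair k_borel, of f M g] by simp

lemma p_pos: "0 < p" "0 \<le> p"
  using p by auto

text \<open>
  The kernel bound makes the integral of \<open>k x y * |S(y) f(y)|\<close> over the cube finite for almost every \<open>x\<close> in it. One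
  such \<open>x\<close> suffices, since \<open>W(x)\<close> is invertible and the integrand dominates \<open>|W(x) f(y)|\<close>.
\<close>

lemma integral_norm_cube_finite:
  fixes f :: "real^'d \<Rightarrow> complex^'n"
  assumes [measurable]: "f \<in> borel_measurable borel" and fin: "energy p S f < top" and s: "0 < s"
  shows "(\<integral>\<^sup>+y. ennreal (norm (f y)) * indicator (cube a s) y \<partial>lborel) < top"
proof -
  define g where "g y = norm (S y *v f y)" for y
  have [measurable]: "g \<in> borel_measurable borel" unfolding g_def by measurable
  define I where "I x = (\<integral>\<^sup>+y. ennreal (k x y * g y) * indicator (cube a s) y \<partial>lborel)" for x
  have [measurable]: "I \<in> borel_measurable borel" unfolding I_def by measurable
  have "(\<integral>\<^sup>+y. ennreal (g y powr p) * indicator (cube a s) y \<partial>lborel) \<le> energy p S f"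
    unfolding energy_def g_def by (intro nn_integral_mono) (auto simp: indicator_def)
  then have "(\<integral>\<^sup>+x. ennpowr (I x) p * indicator (cube a s) x \<partial>lborel) < top"
    using fin averaging[OF s, of g a] unfolding I_def
    by (intro le_less_trans[OF averaging[OF s, of g a]]) (auto simp: ennreal_mult_less_top g_def)
  then have "AE x in lborel. ennpowr (I x) p * indicator (cube a s) x \<noteq> \<infinity>"
    by (intro nn_integral_PInf_AE) auto
  then have AE: "AE x in lborel. x \<in> cube a s \<longrightarrow> I x < top"
    by eventually_elim (auto simp: indicator_def less_top)
  obtain x where x: "x \<in> cube a s" "I x < top"
  proof (rule ccontr)
    assume "\<not> thesis"
    then have "AE x in lborel. x \<notin> cube a s"
      using AE that by (auto elim: eventually_mono)
    then have "(\<integral>\<^sup>+x. indicator (cube a s) x \<partial>lborel) = 0"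
      by (subst nn_integral_0_iff_AE) (auto simp: indicator_def)
    then show False using s by (simp add: emeasure_cube)
  qed
  obtain c where c: "norm v \<le> c * norm (W x *v v)" for v using W_injective by metis
  have "norm (f y) \<le> \<bar>c\<bar> * (k x y * g y)" for y
  proof -
    have "norm (f y) \<le> \<bar>c\<bar> * norm (W x *v f y)"
      using c[of "f y"] mult_right_mono[OF abs_ge_self[of c], of "norm (W x *v f y)"] by simp
    also have "\<dots> \<le> \<bar>c\<bar> * (k x y * g y)"
      unfolding g_def by (intro mult_left_mono k_dominates) auto
    finally show ?thesis .
  qed
  then have "(\<integral>\<^sup>+y. ennreal (norm (f y)) * indicator (cube a s) y \<partial>lborel)
     \<le> (\<integral>\<^sup>+y. ennreal \<bar>c\<bar> * (ennreal (k x y * g y) * indicator (cube a s) y) \<partial>lborel)"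
    by (intro nn_integral_mono) (auto simp: indicator_def k_nonneg g_def simp flip: ennreal_mult intro!: ennreal_leI)
  also have "\<dots> = ennreal \<bar>c\<bar> * I x"
    unfolding I_def by (rule nn_integral_cmult) measurable
  also have "\<dots> < top" using x by (simp add: ennreal_mult_less_top)
  finally show ?thesis .
qed

end

locale mollifier =
  fixes \<phi> :: "real^'d \<Rightarrow> real" and B :: real
  assumes \<phi>_cont: "continuous_on UNIV \<phi>" and \<phi>_nonneg: "\<And>x. 0 \<le> \<phi> x" and \<phi>_le: "\<And>x. \<phi> x \<le> B"
    and \<phi>_support: "\<And>x. 1 \<le> norm x \<Longrightarrow> \<phi> x = 0"
    and \<phi>_integral: "has_bochner_integral lborel \<phi> 1"
begin

lemma B_nonneg: "0 \<le> B"
  using \<phi>_nonneg \<phi>_le order_trans by blast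

lemma \<phi>_borel [measurable]: "\<phi> \<in> borel_measurable borel"
  by (rule borel_measurable_continuous_onI[OF \<phi>_cont])

lemma dilate_borel [measurable]: "dilate \<phi> t \<in> borel_measurable borel"
  unfolding dilate_def by measurable

lemma dilate_nonneg: "0 < t \<Longrightarrow> 0 \<le> dilate \<phi> t x"
  by (simp add: dilate_def \<phi>_nonneg)

lemma dilate_outside:
  assumes "0 < t" "t \<le> norm x" shows "dilate \<phi> t x = 0"
  using \<phi>_support[of "x /\<^sub>R t"] assms by (simp add: dilate_def divide_simps)

lemma dilate_le: "0 < t \<Longrightarrow> dilate \<phi> t x \<le> B / t ^ CARD('d)"
  by (simp add: dilate_def divide_right_mono \<phi>_le)

lemma dilate_integral: "0 < t \<Longrightarrow> has_bochner_integral lborel (\<lambda>y. dilate \<phi> t (x - y)) 1"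
  using integral_reflected_dilation[of t \<phi> x] \<phi>_integral by (simp add: has_bochner_integral_iff)

definition mollify :: "(real^'d \<Rightarrow> complex^'n) \<Rightarrow> real \<Rightarrow> real^'d \<Rightarrow> complex^'n" where
  "mollify f t x = (LINT y|lborel. dilate \<phi> t (x - y) *\<^sub>R f y)"

lemma mollify_borel [measurable]:
  assumes [measurable]: "f \<in> borel_measurable borel"
  shows "mollify f t \<in> borel_measurable borel"
  unfolding mollify_def by measurable

text \<open>
  A point in the middle third of a cube of side \<open>3t\<close> has distance at least \<open>t\<close> from the complement of the cube.
\<close>

lemma dilate_support_cube:
  assumes t: "0 < t" and x: "x \<in> cube (a + (\<chi> i. t)) t" and y: "dilate \<phi> t (x - y) \<noteq> 0"
  shows "y \<in> cube a (3 * t)"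
proof -
  have "norm (x - y) < t" using dilate_outside[OF t, of "x - y"] y by linarith
  then have "\<bar>x $ i - y $ i\<bar> < t" for i
    using component_le_norm_cart[of "x - y" i] by simp
  then have *: "- t < x $ i - y $ i \<and> x $ i - y $ i < t" for i
    by (metis abs_less_iff neg_less_iff_less minus_less_iff)
  show ?thesis unfolding mem_cube_iff
  proof (intro allI conjI)
    fix i
    show "a $ i \<le> y $ i" "y $ i \<le> a $ i + 3 * t"
      using x *[of i] unfolding mem_cube_iff by (auto dest!: spec[of _ i])
  qed
qed

lemma mollify_close:
  fixes h :: "real^'d \<Rightarrow> complex^'n"
  assumes t: "0 < t" and int: "integrable lborel (\<lambda>y. dilate \<phi> t (x - y) *\<^sub>R h y)"
    and close: "\<And>y. norm (x - y) < t \<Longrightarrow> norm (h y - h x) \<le> \<epsilon>"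
  shows "norm (mollify h t x - h x) \<le> \<epsilon>"
proof -
  note d = dilate_integral[OF t, of x]
  then have dint: "integrable lborel (\<lambda>y. dilate \<phi> t (x - y))" by (simp add: has_bochner_integral_iff)
  have intd: "integrable lborel (\<lambda>y. dilate \<phi> t (x - y) *\<^sub>R (h y - h x))"
    using int dint by (simp add: scaleR_diff_right)
  have "mollify h t x - h x = (LINT y|lborel. dilate \<phi> t (x - y) *\<^sub>R (h y - h x))"
    using int d by (simp add: mollify_def scaleR_diff_right has_bochner_integral_iff)
  also have "norm \<dots> \<le> (LINT y|lborel. norm (dilate \<phi> t (x - y) *\<^sub>R (h y - h x)))"
    by (rule integral_norm_bound)
  also have "\<dots> \<le> (LINT y|lborel. dilate \<phi> t (x - y) * \<epsilon>)"
  proof (rule integral_mono)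
    show "integrable lborel (\<lambda>y. norm (dilate \<phi> t (x - y) *\<^sub>R (h y - h x)))"
      using intd by (rule integrable_norm)
    show "integrable lborel (\<lambda>y. dilate \<phi> t (x - y) * \<epsilon>)"
      using dint by simp
    fix y
    show "norm (dilate \<phi> t (x - y) *\<^sub>R (h y - h x)) \<le> dilate \<phi> t (x - y) * \<epsilon>"
      using dilate_nonneg[OF t, of "x - y"] dilate_outside[OF t, of "x - y"] close[of y]
      by (cases "norm (x - y) < t") (auto intro: mult_left_mono)
  qed
  also have "\<dots> = \<epsilon>" using d by (simp add: has_bochner_integral_iff)
  finally show ?thesis .
qed

end

locale mollified_weight_pair = weight_pair W S k p K + mollifier \<phi> B
  for W S :: "real^'d \<Rightarrow> complex^'n^'n" and k p K and \<phi> :: "real^'d \<Rightarrow> real" and B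
begin

lemma integrable_mollify:
  fixes f :: "real^'d \<Rightarrow> complex^'n"
  assumes [measurable]: "f \<in> borel_measurable borel" and fin: "energy p S f < top" and t: "0 < t"
  shows "integrable lborel (\<lambda>y. dilate \<phi> t (x - y) *\<^sub>R f y)"
proof (rule integrableI_bounded)
  define a where "a = x - (\<chi> i. t)"
  have xa: "x \<in> cube (a + (\<chi> i. t)) t" using t by (simp add: a_def mem_cube_iff)
  have "(\<integral>\<^sup>+y. ennreal (norm (dilate \<phi> t (x - y) *\<^sub>R f y)) \<partial>lborel)
     \<le> (\<integral>\<^sup>+y. ennreal (B / t ^ CARD('d)) * (ennreal (norm (f y)) * indicator (cube a (3 * t)) y) \<partial>lborel)"
  proof (rule nn_integral_mono)
    fix y
    show "ennreal (norm (dilate \<phi> t (x - y) *\<^sub>R f y))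
      \<le> ennreal (B / t ^ CARD('d)) * (ennreal (norm (f y)) * indicator (cube a (3 * t)) y)"
      using dilate_support_cube[OF t xa, of y] dilate_nonneg[OF t, of "x - y"] B_nonneg t
        mult_right_mono[OF dilate_le[OF t, of "x - y"] norm_ge_zero[of "f y"]]
      by (cases "dilate \<phi> t (x - y) = 0") (auto simp flip: ennreal_mult intro!: ennreal_leI)
  qed
  also have "\<dots> = ennreal (B / t ^ CARD('d)) * (\<integral>\<^sup>+y. ennreal (norm (f y)) * indicator (cube a (3 * t)) y \<partial>lborel)"
    by (rule nn_integral_cmult) measurable
  also have "\<dots> < \<infinity>"
    using integral_norm_cube_finite[OF _ fin, of "3 * t" a] t by (simp add: ennreal_mult_less_top)
  finally show "(\<integral>\<^sup>+y. ennreal (norm (dilate \<phi> t (x - y) *\<^sub>R f y)) \<partial>lborel) < \<infinity>" .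
qed measurable

lemma norm_weight_mollify_le:
  fixes f :: "real^'d \<Rightarrow> complex^'n"
  assumes [measurable]: "f \<in> borel_measurable borel" and fin: "energy p S f < top" and t: "0 < t"
    and x: "x \<in> cube (a + (\<chi> i. t)) t"
  shows "ennreal (norm (W x *v mollify f t x)) \<le> ennreal (B / t ^ CARD('d)) *
    (\<integral>\<^sup>+y. ennreal (k x y * norm (S y *v f y)) * indicator (cube a (3 * t)) y \<partial>lborel)"
proof -
  note int = integrable_mollify[OF assms(1) fin t, of x]
  have "W x *v mollify f t x = (LINT y|lborel. W x *v (dilate \<phi> t (x - y) *\<^sub>R f y))"
    unfolding mollify_def by (rule integral_bounded_linear[OF bounded_linear_matrix_vector int, symmetric])
  also have "ennreal (norm \<dots>) \<le> (\<integral>\<^sup>+y. ennreal (norm (W x *v (dilate \<phi> t (x - y) *\<^sub>R f y))) \<partial>lborel)"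
    by (intro integral_norm_bound_ennreal integrable_bounded_linear[OF bounded_linear_matrix_vector int])
  also have "\<dots> \<le> (\<integral>\<^sup>+y. ennreal (B / t ^ CARD('d)) *
      (ennreal (k x y * norm (S y *v f y)) * indicator (cube a (3 * t)) y) \<partial>lborel)"
  proof (rule nn_integral_mono)
    fix y
    have "dilate \<phi> t (x - y) * norm (W x *v f y) \<le> B / t ^ CARD('d) * (k x y * norm (S y *v f y))"
      using dilate_le[OF t] dilate_nonneg[OF t] B_nonneg t
      by (intro mult_mono k_dominates) auto
    then show "ennreal (norm (W x *v (dilate \<phi> t (x - y) *\<^sub>R f y)))
      \<le> ennreal (B / t ^ CARD('d)) * (ennreal (k x y * norm (S y *v f y)) * indicator (cube a (3 * t)) y)"
      using dilate_support_cube[OF t x, of y] dilate_nonneg[OF t, of "x - y"] B_nonneg t k_nonneg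
      by (cases "dilate \<phi> t (x - y) = 0")
        (auto simp: matrix_vector_scaleR simp flip: ennreal_mult intro!: ennreal_leI)
  qed
  also have "\<dots> = ennreal (B / t ^ CARD('d)) *
      (\<integral>\<^sup>+y. ennreal (k x y * norm (S y *v f y)) * indicator (cube a (3 * t)) y \<partial>lborel)"
    by (rule nn_integral_cmult) measurable
  finally show ?thesis .
qed

definition mollify_const :: real where
  "mollify_const = 3 ^ CARD('d) * (K * (B * 3 ^ CARD('d)) powr p)"

lemma mollify_const_nonneg: "0 \<le> mollify_const"
  using K by (simp add: mollify_const_def)

text \<open>
  The pointwise estimate \<open>norm_weight_mollify_le\<close> is integrated over the middle third of a cube of side \<open>3t\<close>, and
  the kernel bound is applied on the cube itself. Integrating over all positions of the cube produces the factors
  \<open>t^d\<close> on the left and \<open>(3t)^d\<close> on the right, so the constant does not depend on \<open>t\<close>.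
\<close>

lemma energy_mollify_le:
  fixes f :: "real^'d \<Rightarrow> complex^'n"
  assumes [measurable]: "f \<in> borel_measurable borel" and fin: "energy p S f < top" and t: "0 < t"
  shows "energy p W (mollify f t) \<le> ennreal mollify_const * energy p S f"
proof -
  let ?F = "\<lambda>x. ennreal (norm (W x *v mollify f t x) powr p)"
  let ?G = "\<lambda>y. ennreal (norm (S y *v f y) powr p)"
  let ?I = "\<lambda>a x. \<integral>\<^sup>+y. ennreal (k x y * norm (S y *v f y)) * indicator (cube a (3 * t)) y \<partial>lborel"
  define c where "c = K * (B * 3 ^ CARD('d)) powr p"
  have c: "0 \<le> c" using K by (simp add: c_def)
  define \<tau> :: "real^'d" where "\<tau> = (\<chi> i. t)"
  have local: "(\<integral>\<^sup>+x. ?F x * indicator (cube (a + \<tau>) t) x \<partial>lborel)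
      \<le> ennreal c * (\<integral>\<^sup>+y. ?G y * indicator (cube a (3 * t)) y \<partial>lborel)" for a
  proof -
    have "(\<integral>\<^sup>+x. ?F x * indicator (cube (a + \<tau>) t) x \<partial>lborel)
      \<le> (\<integral>\<^sup>+x. ennreal ((B / t ^ CARD('d)) powr p) * (ennpowr (?I a x) p * indicator (cube a (3 * t)) x) \<partial>lborel)"
    proof (rule nn_integral_mono)
      fix x
      show "?F x * indicator (cube (a + \<tau>) t) x
        \<le> ennreal ((B / t ^ CARD('d)) powr p) * (ennpowr (?I a x) p * indicator (cube a (3 * t)) x)"
      proof (cases "x \<in> cube (a + \<tau>) t")
        case True
        then have *: "a $ i + t \<le> x $ i \<and> x $ i \<le> a $ i + t + t" for i
          unfolding mem_cube_iff \<tau>_def by simp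
        have "x \<in> cube a (3 * t)"
          unfolding mem_cube_iff
        proof (intro allI conjI)
          fix i show "a $ i \<le> x $ i" "x $ i \<le> a $ i + 3 * t" using *[of i] t by linarith+
        qed
        moreover have "?F x \<le> ennreal ((B / t ^ CARD('d)) powr p) * ennpowr (?I a x) p"
        proof -
          have "?F x = ennpowr (ennreal (norm (W x *v mollify f t x))) p"
            by (simp add: ennpowr_ennreal)
          also have "\<dots> \<le> ennpowr (ennreal (B / t ^ CARD('d)) * ?I a x) p"
            using True by (intro ennpowr_mono norm_weight_mollify_le fin t p_pos) (auto simp: \<tau>_def)
          also have "\<dots> = ennreal ((B / t ^ CARD('d)) powr p) * ennpowr (?I a x) p"
            using B_nonneg t by (simp add: ennpowr_mult ennpowr_ennreal)
          finally show ?thesis .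
        qed
        ultimately show ?thesis using True by simp
      qed simp
    qed
    also have "\<dots> = ennreal ((B / t ^ CARD('d)) powr p) *
        (\<integral>\<^sup>+x. ennpowr (?I a x) p * indicator (cube a (3 * t)) x \<partial>lborel)"
      by (rule nn_integral_cmult) measurable
    also have "\<dots> \<le> ennreal ((B / t ^ CARD('d)) powr p) * (ennreal (K * ((3 * t) ^ CARD('d)) powr p) *
        (\<integral>\<^sup>+y. ?G y * indicator (cube a (3 * t)) y \<partial>lborel))"
      using t by (intro mult_left_mono averaging) auto
    also have "\<dots> = ennreal c * (\<integral>\<^sup>+y. ?G y * indicator (cube a (3 * t)) y \<partial>lborel)"
    proof -
      have "(B / t ^ CARD('d)) powr p * (K * ((3 * t) ^ CARD('d)) powr p)
          = K * (B / t ^ CARD('d) * (3 * t) ^ CARD('d)) powr p"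
        using B_nonneg t by (simp add: powr_mult powr_divide)
      also have "B / t ^ CARD('d) * (3 * t) ^ CARD('d) = B * 3 ^ CARD('d)"
        using t by (simp add: power_mult_distrib)
      finally have *: "c = (B / t ^ CARD('d)) powr p * (K * ((3 * t) ^ CARD('d)) powr p)"
        by (simp only: c_def)
      have "ennreal c = ennreal ((B / t ^ CARD('d)) powr p) * ennreal (K * ((3 * t) ^ CARD('d)) powr p)"
        unfolding * using K by (intro ennreal_mult) auto
      then show ?thesis by (simp add: mult.assoc)
    qed
    finally show ?thesis .
  qed
  have "ennreal (t ^ CARD('d)) * energy p W (mollify f t)
      = (\<integral>\<^sup>+a. (\<integral>\<^sup>+x. ?F x * indicator (cube (a + \<tau>) t) x \<partial>lborel) \<partial>lborel)"
    unfolding energy_def using t by (subst nn_integral_sweep_cubes) auto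
  also have "\<dots> \<le> (\<integral>\<^sup>+a. ennreal c * (\<integral>\<^sup>+y. ?G y * indicator (cube (a + 0) (3 * t)) y \<partial>lborel) \<partial>lborel)"
    using local by (intro nn_integral_mono) simp
  also have "\<dots> = ennreal c * (\<integral>\<^sup>+a. (\<integral>\<^sup>+y. ?G y * indicator (cube (a + 0) (3 * t)) y \<partial>lborel) \<partial>lborel)"
  proof (rule nn_integral_cmult)
    have "indicator (cube (a + 0) (3 * t)) y = (indicator (cube 0 (3 * t)) (y - a) :: ennreal)" for a y :: "real^'d"
      by (auto simp: indicator_def mem_box_cart le_diff_eq diff_le_eq add_ac)
    then show "(\<lambda>a. \<integral>\<^sup>+y. ?G y * indicator (cube (a + 0) (3 * t)) y \<partial>lborel) \<in> borel_measurable lborel"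
      by (simp only:) measurable
  qed
  also have "\<dots> = ennreal c * (ennreal ((3 * t) ^ CARD('d)) * energy p S f)"
    unfolding energy_def using t by (subst nn_integral_sweep_cubes) auto
  also have "\<dots> = ennreal (t ^ CARD('d)) * (ennreal mollify_const * energy p S f)"
  proof -
    have "ennreal c * ennreal ((3 * t) ^ CARD('d)) = ennreal (t ^ CARD('d)) * ennreal mollify_const"
      using c t mollify_const_nonneg
      by (simp add: mollify_const_def power_mult_distrib mult_ac flip: c_def ennreal_mult)
    then show ?thesis by (simp add: mult.assoc[symmetric])
  qed
  finally show ?thesis
    using t by (subst (asm) ennreal_mult_le_mult_iff) auto
qed

lemma mollify_diff:
  fixes f g :: "real^'d \<Rightarrow> complex^'n"
  assumes "f \<in> borel_measurable borel" "g \<in> borel_measurable borel"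
    and "energy p S f < top" "energy p S g < top" "0 < t"
  shows "mollify (\<lambda>x. f x - g x) t x = mollify f t x - mollify g t x"
  using integrable_mollify[of f t x] integrable_mollify[of g t x] assms
  unfolding mollify_def by (simp add: scaleR_diff_right)

lemma energy_compact_support_finite:
  fixes h :: "real^'d \<Rightarrow> complex^'n"
  assumes cont: "continuous_on UNIV h" and supp: "\<And>x. r < norm x \<Longrightarrow> h x = 0"
  shows "energy p S h < top"
proof -
  have "bounded (h ` cball 0 r)"
    using cont by (intro compact_imp_bounded compact_continuous_image continuous_on_subset[OF cont]) auto
  then obtain m where m: "0 \<le> m" "\<And>x. x \<in> cball 0 r \<Longrightarrow> norm (h x) \<le> m"
    unfolding bounded_pos by (metis image_eqI less_imp_le)
  have "energy p S h \<le> (\<integral>\<^sup>+x. ennreal ((op_norm (S x) * m * indicator (cball 0 r) x) powr p) \<partial>lborel)"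
    unfolding energy_def
  proof (intro nn_integral_mono ennreal_leI powr_mono2 p_pos norm_ge_zero)
    fix x
    have "norm (S x *v h x) \<le> op_norm (S x) * norm (h x)" by (rule norm_le_op_norm)
    also have "\<dots> \<le> op_norm (S x) * (m * indicator (cball 0 r) x)"
      using m supp[of x] by (intro mult_left_mono op_norm_nonneg) (auto simp: indicator_def)
    finally show "norm (S x *v h x) \<le> op_norm (S x) * m * indicator (cball 0 r) x" by (simp add: mult.assoc)
  qed
  also have "\<dots> < top" using m by (intro energy_bounded_support_finite S_loc p_pos) auto
  finally show ?thesis .
qed

lemma energy_mollify_compact_support_tendsto:
  fixes h :: "real^'d \<Rightarrow> complex^'n"
  assumes cont: "continuous_on UNIV h" and supp: "\<And>x. r < norm x \<Longrightarrow> h x = 0"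
  shows "((\<lambda>t. energy p W (\<lambda>x. mollify h t x - h x)) \<longlongrightarrow> 0) (at_right 0)"
proof -
  define L where "L = (\<integral>\<^sup>+x. ennreal (op_norm (W x) powr p) * indicator (cball 0 (r + 1)) x \<partial>lborel)"
  have [measurable]: "h \<in> borel_measurable borel" by (rule borel_measurable_continuous_onI[OF cont])
  note fin = energy_compact_support_finite[OF cont supp]
  show ?thesis
  proof (rule tendsto_ennreal_0I[of L])
    show "L < top" unfolding L_def by (rule W_loc)
    fix \<eta> :: real assume \<eta>: "0 < \<eta>"
    define \<epsilon> where "\<epsilon> = \<eta> powr (1 / p)"
    have \<epsilon>: "0 < \<epsilon>" "\<epsilon> powr p = \<eta>" using \<eta> p_pos by (auto simp: \<epsilon>_def powr_powr)
    have "uniformly_continuous_on (cball 0 (r + 2)) h"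
      by (intro compact_uniformly_continuous continuous_on_subset[OF cont]) auto
    then obtain \<delta> where \<delta>: "0 < \<delta>"
      "\<And>x y. x \<in> cball 0 (r + 2) \<Longrightarrow> y \<in> cball 0 (r + 2) \<Longrightarrow> dist y x < \<delta> \<Longrightarrow> dist (h y) (h x) < \<epsilon>"
      using \<epsilon>(1) unfolding uniformly_continuous_on_def by metis
    have "\<forall>\<^sub>F t in at_right 0. t \<in> {0<..<min \<delta> 1}"
      using \<delta>(1) by (intro eventually_at_right_real) auto
    then show "\<forall>\<^sub>F t in at_right 0. energy p W (\<lambda>x. mollify h t x - h x) \<le> ennreal \<eta> * L"
    proof eventually_elim
      fix t assume "t \<in> {0<..<min \<delta> 1}"
      then have t: "0 < t" "t < \<delta>" "t < 1" by auto
      note int = integrable_mollify[OF _ fin t(1)]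
      have close: "norm (mollify h t x - h x) \<le> \<epsilon> * indicator (cball 0 (r + 1)) x" for x
      proof (rule mollify_close[OF t(1) int])
        fix y assume y: "norm (x - y) < t"
        have tri: "norm x \<le> norm (x - y) + norm y" "norm y \<le> norm (x - y) + norm x"
          using norm_triangle_ineq[of "x - y" y] norm_triangle_ineq[of "y - x" x]
          by (auto simp: norm_minus_commute)
        show "norm (h y - h x) \<le> \<epsilon> * indicator (cball 0 (r + 1)) x"
        proof (cases "norm x \<le> r + 1")
          case True
          then have "dist (h y) (h x) < \<epsilon>"
            using tri y t by (intro \<delta>) (auto simp: dist_norm norm_minus_commute)
          then show ?thesis using True by (simp add: dist_norm)
        next
          case False
          then have "h x = 0" "h y = 0" using tri y t by (auto intro!: supp)
          then show ?thesis using False by simp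
        qed
      qed measurable
      have "energy p W (\<lambda>x. mollify h t x - h x)
        \<le> (\<integral>\<^sup>+x. ennreal \<eta> * (ennreal (op_norm (W x) powr p) * indicator (cball 0 (r + 1)) x) \<partial>lborel)"
        unfolding energy_def
      proof (rule nn_integral_mono)
        fix x
        have "norm (W x *v (mollify h t x - h x)) \<le> op_norm (W x) * (\<epsilon> * indicator (cball 0 (r + 1)) x)"
          by (intro order_trans[OF norm_le_op_norm] mult_left_mono close op_norm_nonneg)
        then have "norm (W x *v (mollify h t x - h x)) powr p
            \<le> (op_norm (W x) * (\<epsilon> * indicator (cball 0 (r + 1)) x)) powr p"
          using p_pos by (intro powr_mono2) auto
        also have "\<dots> = \<eta> * (op_norm (W x) powr p * indicator (cball 0 (r + 1)) x)"
          using op_norm_nonneg[of "W x"] \<epsilon> p_pos by (auto simp: indicator_def powr_mult)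
        finally have "ennreal (norm (W x *v (mollify h t x - h x)) powr p)
            \<le> ennreal (\<eta> * (op_norm (W x) powr p * indicator (cball 0 (r + 1)) x))"
          by (rule ennreal_leI)
        then show "ennreal (norm (W x *v (mollify h t x - h x)) powr p)
            \<le> ennreal \<eta> * (ennreal (op_norm (W x) powr p) * indicator (cball 0 (r + 1)) x)"
          using \<eta> by (auto simp: indicator_def ennreal_mult split: if_splits)
      qed
      also have "\<dots> = ennreal \<eta> * L"
        unfolding L_def by (rule nn_integral_cmult) measurable
      finally show "energy p W (\<lambda>x. mollify h t x - h x) \<le> ennreal \<eta> * L" .
    qed
  qed
qed

definition embed_const :: real where
  "embed_const = 2 powr p * mollify_const"

text \<open>
  The limit as \<open>t\<close> tends to \<open>0\<close> of the uniform bound for \<open>mollify h t\<close>.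
\<close>

lemma energy_embed_compact_support:
  fixes h :: "real^'d \<Rightarrow> complex^'n"
  assumes cont: "continuous_on UNIV h" and supp: "\<And>x. r < norm x \<Longrightarrow> h x = 0"
  shows "energy p W h \<le> ennreal embed_const * energy p S h"
proof -
  have [measurable]: "h \<in> borel_measurable borel" by (rule borel_measurable_continuous_onI[OF cont])
  note fin = energy_compact_support_finite[OF cont supp]
  have "energy p W h \<le> ennreal (2 powr p) * (energy p W (\<lambda>x. mollify h t x - h x) + ennreal mollify_const * energy p S h)"
    if "0 < t" for t
  proof -
    have "energy p W (\<lambda>x. (h x - mollify h t x) + mollify h t x)
      \<le> ennreal (2 powr p) * (energy p W (\<lambda>x. h x - mollify h t x) + energy p W (mollify h t))"
      using p_pos by (intro energy_add_le) auto
    also have "\<dots> \<le> ennreal (2 powr p) * (energy p W (\<lambda>x. mollify h t x - h x) + ennreal mollify_const * energy p S h)"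
      using that fin by (subst energy_minus_commute, intro mult_left_mono add_left_mono energy_mollify_le) auto
    finally show ?thesis by simp
  qed
  then have ev: "\<forall>\<^sub>F t in at_right 0. energy p W h
      \<le> ennreal (2 powr p) * (energy p W (\<lambda>x. mollify h t x - h x) + ennreal mollify_const * energy p S h)"
    by (auto simp: eventually_at_right_less intro: eventually_mono[OF eventually_at_right_less])
  have "((\<lambda>t. ennreal (2 powr p) * (energy p W (\<lambda>x. mollify h t x - h x) + ennreal mollify_const * energy p S h))
      \<longlongrightarrow> ennreal (2 powr p) * (0 + ennreal mollify_const * energy p S h)) (at_right 0)"
    by (intro ennreal_tendsto_cmult tendsto_add tendsto_const energy_mollify_compact_support_tendsto[OF cont supp]) auto
  from tendsto_lowerbound[OF this ev] have "energy p W h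
      \<le> ennreal (2 powr p) * (0 + ennreal mollify_const * energy p S h)" by simp
  then show ?thesis
    by (simp add: embed_const_def ennreal_mult mollify_const_nonneg mult.assoc)
qed

text \<open>
  Fatou's lemma on the side of \<open>W\<close> and dominated convergence on the side of \<open>S\<close> carry the inequality through the
  two limits of the density principle.
\<close>

lemma energy_embed:
  fixes f :: "real^'d \<Rightarrow> complex^'n"
  assumes f: "f \<in> borel_measurable borel" and fin: "energy p S f < top"
  shows "energy p W f \<le> ennreal embed_const * energy p S f"
  using S_borel p_pos(2) S_loc f fin
proof (induction rule: weighted_Lp_induct)
  case (continuous h r)
  then show ?case by (rule energy_embed_compact_support)
next
  case (limit f F G)
  note [measurable] = limit.hyps(1,2)
  have "energy p W f = (\<integral>\<^sup>+x. liminf (\<lambda>n. ennreal (norm (W x *v F n x) powr p)) \<partial>lborel)"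
    unfolding energy_def
  proof (rule nn_integral_cong_AE)
    show "AE x in lborel. ennreal (norm (W x *v f x) powr p) = liminf (\<lambda>n. ennreal (norm (W x *v F n x) powr p))"
      using limit.hyps(4)
    proof eventually_elim
      fix x assume x: "(\<lambda>n. F n x) \<longlonglongrightarrow> f x"
      have "(\<lambda>n. W x *v F n x) \<longlonglongrightarrow> W x *v f x"
        by (rule bounded_linear.tendsto[OF bounded_linear_matrix_vector x])
      then have "(\<lambda>n. ennreal (norm (W x *v F n x) powr p)) \<longlonglongrightarrow> ennreal (norm (W x *v f x) powr p)"
        using p_pos by (intro tendsto_intros tendsto_powr') auto
      then show "ennreal (norm (W x *v f x) powr p) = liminf (\<lambda>n. ennreal (norm (W x *v F n x) powr p))"
        by (rule lim_imp_Liminf[OF sequentially_bot, symmetric])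
    qed
  qed
  also have "\<dots> \<le> liminf (\<lambda>n. energy p W (F n))"
    unfolding energy_def by (rule nn_integral_liminf) measurable
  also have "\<dots> \<le> liminf (\<lambda>n. ennreal embed_const * energy p S (F n))"
    by (intro Liminf_mono always_eventually allI limit.IH)
  also have "\<dots> = ennreal embed_const * energy p S f"
  proof -
    have "(\<lambda>n. energy p S (F n)) \<longlonglongrightarrow> energy p S f"
      by (rule energy_dominated_convergence(1)[OF S_borel p_pos(1) limit.hyps])
    then have "(\<lambda>n. ennreal embed_const * energy p S (F n)) \<longlonglongrightarrow> ennreal embed_const * energy p S f"
      by (intro ennreal_tendsto_cmult) auto
    then show ?thesis by (simp add: lim_imp_Liminf)
  qed
  finally show ?case .
qed

text \<open>
  The splitting \<open>\<phi>\<^sub>t * f - f = \<phi>\<^sub>t * (f - F) + (\<phi>\<^sub>t * F - F) + (F - f)\<close>, where \<open>F\<close> is close to \<open>f\<close> in the space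
  of \<open>S\<close>: the uniform bound controls the first term, the embedding the last one.
\<close>

lemma energy_mollify_tendsto:
  fixes f :: "real^'d \<Rightarrow> complex^'n"
  assumes f: "f \<in> borel_measurable borel" and fin: "energy p S f < top"
  shows "((\<lambda>t. energy p W (\<lambda>x. mollify f t x - f x)) \<longlongrightarrow> 0) (at_right 0)"
proof -
  have "energy p S f < top \<longrightarrow> ((\<lambda>t. energy p W (\<lambda>x. mollify f t x - f x)) \<longlongrightarrow> 0) (at_right 0)"
    using S_borel p_pos(2) S_loc f fin
  proof (induction rule: weighted_Lp_induct)
    case (continuous h r)
    then show ?case by (intro impI energy_mollify_compact_support_tendsto)
  next
    case (limit f F G)
    note [measurable] = limit.hyps(1,2,3)
    define D where "D = ennreal (2 powr p) * (ennreal mollify_const + ennreal (2 powr p) * (1 + ennreal embed_const))"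
    show ?case
    proof (intro impI tendsto_ennreal_0I[of D])
      assume fin: "energy p S f < top"
      show "D < top" by (auto simp: D_def ennreal_mult_less_top)
      fix \<epsilon> :: real assume \<epsilon>: "0 < \<epsilon>"
      have finF: "energy p S (F n) < top" for n
      proof -
        have "energy p S (F n) \<le> (\<integral>\<^sup>+x. ennreal (G x powr p) \<partial>lborel)"
          unfolding energy_def using limit.hyps(5) p_pos
          by (intro nn_integral_mono ennreal_leI powr_mono2) auto
        then show ?thesis using limit.hyps(6) by (rule le_less_trans)
      qed
      have "(\<lambda>n. energy p S (\<lambda>x. F n x - f x)) \<longlonglongrightarrow> 0"
        by (rule energy_dominated_convergence(2)[OF S_borel p_pos(1) limit.hyps])
      then have "\<forall>\<^sub>F n in sequentially. energy p S (\<lambda>x. F n x - f x) < ennreal \<epsilon>"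
        using \<epsilon> by (intro order_tendstoD) auto
      then obtain n where n: "energy p S (\<lambda>x. F n x - f x) < ennreal \<epsilon>"
        by (auto simp: eventually_sequentially)
      then have n': "energy p S (\<lambda>x. f x - F n x) < ennreal \<epsilon>"
        by (subst energy_minus_commute)
      have lim: "((\<lambda>t. energy p W (\<lambda>x. mollify (F n) t x - F n x)) \<longlongrightarrow> 0) (at_right 0)"
        using limit.IH finF by blast
      have "\<forall>\<^sub>F t in at_right 0. energy p W (\<lambda>x. mollify (F n) t x - F n x) < ennreal \<epsilon> \<and> 0 < t"
        using \<epsilon> by (intro eventually_conj order_tendstoD(2)[OF lim] eventually_at_right_less) simp
      then show "\<forall>\<^sub>F t in at_right 0. energy p W (\<lambda>x. mollify f t x - f x) \<le> ennreal \<epsilon> * D"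
      proof (eventually_elim, elim conjE)
        fix t :: real assume b: "energy p W (\<lambda>x. mollify (F n) t x - F n x) < ennreal \<epsilon>" and t: "0 < t"
        have "energy p W (mollify (\<lambda>x. f x - F n x) t) \<le> ennreal mollify_const * energy p S (\<lambda>x. f x - F n x)"
          using less_trans[OF n' ennreal_less_top] by (intro energy_mollify_le t) auto
        also have "\<dots> \<le> ennreal mollify_const * ennreal \<epsilon>"
          using n' by (intro mult_left_mono) auto
        finally have a: "energy p W (mollify (\<lambda>x. f x - F n x) t) \<le> ennreal mollify_const * ennreal \<epsilon>" .
        have "energy p W (\<lambda>x. F n x - f x) \<le> ennreal embed_const * energy p S (\<lambda>x. F n x - f x)"
          using less_trans[OF n ennreal_less_top] by (intro energy_embed) auto
        also have "\<dots> \<le> ennreal embed_const * ennreal \<epsilon>"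
          using n by (intro mult_left_mono) auto
        finally have c: "energy p W (\<lambda>x. F n x - f x) \<le> ennreal embed_const * ennreal \<epsilon>" .
        have "energy p W (\<lambda>x. mollify f t x - f x)
          = energy p W (\<lambda>x. mollify (\<lambda>x. f x - F n x) t x + ((mollify (F n) t x - F n x) + (F n x - f x)))"
          using t fin finF by (simp add: mollify_diff)
        also have "\<dots> \<le> ennreal (2 powr p) * (energy p W (mollify (\<lambda>x. f x - F n x) t)
            + energy p W (\<lambda>x. (mollify (F n) t x - F n x) + (F n x - f x)))"
          using p_pos by (intro energy_add_le) auto
        also have "\<dots> \<le> ennreal (2 powr p) * (energy p W (mollify (\<lambda>x. f x - F n x) t)
            + ennreal (2 powr p) * (energy p W (\<lambda>x. mollify (F n) t x - F n x) + energy p W (\<lambda>x. F n x - f x)))"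
          using p_pos by (intro mult_left_mono add_left_mono energy_add_le) auto
        also have "\<dots> \<le> ennreal (2 powr p) * (ennreal mollify_const * ennreal \<epsilon>
            + ennreal (2 powr p) * (ennreal \<epsilon> + ennreal embed_const * ennreal \<epsilon>))"
          using a b c by (intro mult_left_mono add_mono) auto
        also have "\<dots> = ennreal \<epsilon> * D"
          by (simp add: D_def algebra_simps)
        finally show "energy p W (\<lambda>x. mollify f t x - f x) \<le> ennreal \<epsilon> * D" .
      qed
    qed
  qed
  then show ?thesis using fin by simp
qed

end

section \<open>Borel versions of weights\<close>

lemma borel_measurable_vecI:
  fixes f :: "'a \<Rightarrow> ('b::euclidean_space)^'n"
  assumes "\<And>i. (\<lambda>x. f x $ i) \<in> borel_measurable M"
  shows "f \<in> borel_measurable M"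
proof (subst borel_measurable_euclidean_space, intro ballI)
  fix b :: "'b^'n" assume "b \<in> Basis"
  then obtain i u where "b = axis i u" by (auto simp: Basis_vec_def)
  then show "(\<lambda>x. f x \<bullet> b) \<in> borel_measurable M"
    using assms[of i] by (simp add: inner_axis)
qed

lemma borel_measurable_vec_nth [measurable (raw)]:
  fixes f :: "'a \<Rightarrow> ('b::euclidean_space)^'n"
  assumes "f \<in> borel_measurable M"
  shows "(\<lambda>x. f x $ i) \<in> borel_measurable M"
  by (rule borel_measurable_continuous_on[OF _ assms]) (intro continuous_intros)

lemma lebesgue_measurable_borel_version:
  fixes f :: "real^'d \<Rightarrow> 'b::euclidean_space"
  assumes [measurable]: "f \<in> borel_measurable lebesgue"
  obtains f' where "f' \<in> borel_measurable borel" "AE x in lborel. f x = f' x"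
proof -
  have "\<exists>g. g \<in> borel_measurable lborel \<and> (AE x in lborel. f x \<bullet> b = g x)" for b
    using completion_ex_borel_measurable_real[of "\<lambda>x. f x \<bullet> b" lborel] by auto
  then obtain g where g [measurable]: "\<And>b. g b \<in> borel_measurable lborel"
    and eq: "\<And>b. AE x in lborel. f x \<bullet> b = g b x"
    by metis
  have "AE x in lborel. \<forall>b\<in>Basis. f x \<bullet> b = g b x"
    using eq by (intro AE_finite_allI) auto
  then have "AE x in lborel. f x = (\<Sum>b\<in>Basis. g b x *\<^sub>R b)"
  proof eventually_elim
    fix x assume "\<forall>b\<in>Basis. f x \<bullet> b = g b x"
    then have "(\<Sum>b\<in>Basis. g b x *\<^sub>R b) = (\<Sum>b\<in>Basis. (f x \<bullet> b) *\<^sub>R b)" by simp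
    then show "f x = (\<Sum>b\<in>Basis. g b x *\<^sub>R b)" by (simp only: euclidean_representation)
  qed
  then show ?thesis
    by (rule that[rotated]) measurable
qed

lemma pos_def_mat_1: "pos_def (mat 1)"
proof -
  have "ctranspose (mat 1) = (mat 1 :: complex^'a^'a)"
    by (simp add: ctranspose_def mat_def vec_eq_iff)
  moreover have "Re (\<Sum>i\<in>UNIV. cnj (v $ i) * v $ i) = (norm v)\<^sup>2" for v :: "complex^'a"
    using cinner_self[of v] by (simp add: cinner_def)
  ultimately show ?thesis by (simp add: pos_def_def self_adjoint_def)
qed

text \<open>
  On the exceptional null set the weight is replaced by the identity matrix, so that the Borel version is positive
  definite at every point and all statements about its powers hold without exceptions.
\<close>

lemma matrix_weight_borel_version:
  fixes U :: "real^'d \<Rightarrow> complex^'n^'n"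
  assumes U: "matrix_weight U"
  shows "\<exists>U'. U' \<in> borel_measurable borel \<and> (\<forall>x. pos_def (U' x)) \<and> (AE x in lborel. U x = U' x) \<and>
    (\<forall>r. (\<integral>\<^sup>+x. ennreal (op_norm (U' x)) * indicator (cball 0 r) x \<partial>lborel) < top)"
proof -
  have int: "integrable lebesgue (\<lambda>x. indicator (cball 0 r) x *\<^sub>R (U x $ i $ j))" for i j r
    using U by (simp add: matrix_weight_def set_integrable_def)
  have "(\<lambda>x. U x $ i $ j) \<in> borel_measurable lebesgue" for i j
  proof (rule borel_measurable_LIMSEQ_metric)
    show "(\<lambda>x. indicator (cball 0 (real n)) x *\<^sub>R (U x $ i $ j)) \<in> borel_measurable lebesgue" for n
      using int by (rule borel_measurable_integrable)
    show "(\<lambda>n. indicator (cball 0 (real n)) x *\<^sub>R (U x $ i $ j)) \<longlonglongrightarrow> U x $ i $ j" for x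
    proof (rule tendsto_eventually)
      show "\<forall>\<^sub>F n in sequentially. indicator (cball 0 (real n)) x *\<^sub>R (U x $ i $ j) = U x $ i $ j"
        using eventually_ge_at_top[of "nat \<lceil>norm x\<rceil>"]
      proof eventually_elim
        fix n assume "nat \<lceil>norm x\<rceil> \<le> n"
        then have "norm x \<le> real n" by linarith
        then show "indicator (cball 0 (real n)) x *\<^sub>R (U x $ i $ j) = U x $ i $ j" by simp
      qed
    qed
  qed
  then have "U \<in> borel_measurable lebesgue" by (intro borel_measurable_vecI)
  then obtain U0 where U0 [measurable]: "U0 \<in> borel_measurable borel" and eq0: "AE x in lborel. U x = U0 x"
    by (rule lebesgue_measurable_borel_version)
  have "AE x in lborel. pos_def (U x)"
    using U by (simp add: matrix_weight_def AE_completion_iff)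
  then have "AE x in lborel. pos_def (U0 x)"
    using eq0 by eventually_elim simp
  then obtain N where N: "{x \<in> space lborel. \<not> pos_def (U0 x)} \<subseteq> N" "emeasure lborel N = 0" "N \<in> sets lborel"
    by (rule AE_E)
  define U' where "U' x = (if x \<in> N then mat 1 else U0 x)" for x
  have U' [measurable]: "U' \<in> borel_measurable borel"
    unfolding U'_def using N(3) by (intro measurable_If_set) auto
  have "AE x in lborel. x \<notin> N"
    using N by (intro AE_not_in) (auto simp: null_sets_def)
  then have eq: "AE x in lborel. U x = U' x"
    using eq0 by eventually_elim (simp add: U'_def)
  have loc: "(\<integral>\<^sup>+x. ennreal (op_norm (U' x)) * indicator (cball 0 r) x \<partial>lborel) < top" for r
  proof -
    have entry: "(\<integral>\<^sup>+x. ennreal (norm (U' x $ i $ j)) * indicator (cball 0 r) x \<partial>lborel) < top" for i j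
    proof -
      have "(\<integral>\<^sup>+x. ennreal (norm (U' x $ i $ j)) * indicator (cball 0 r) x \<partial>lborel)
        = (\<integral>\<^sup>+x. ennreal (norm (indicator (cball 0 r) x *\<^sub>R (U x $ i $ j))) \<partial>lborel)"
        using eq by (intro nn_integral_cong_AE, eventually_elim) (auto simp: indicator_def)
      also have "\<dots> < \<infinity>"
        using int[of r i j] unfolding integrable_iff_bounded nn_integral_completion by simp
      finally show ?thesis by simp
    qed
    have "(\<integral>\<^sup>+x. ennreal (op_norm (U' x)) * indicator (cball 0 r) x \<partial>lborel)
      \<le> (\<integral>\<^sup>+x. (\<Sum>i\<in>UNIV. \<Sum>j\<in>UNIV. ennreal (norm (U' x $ i $ j)) * indicator (cball 0 r) x) \<partial>lborel)"
    proof (rule nn_integral_mono)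
      fix x
      have "ennreal (op_norm (U' x)) \<le> ennreal (\<Sum>i\<in>UNIV. \<Sum>j\<in>UNIV. norm (U' x $ i $ j))"
        by (intro ennreal_leI op_norm_le_sum_entries)
      also have "\<dots> = (\<Sum>i\<in>UNIV. \<Sum>j\<in>UNIV. ennreal (norm (U' x $ i $ j)))"
        by (simp add: sum_ennreal[symmetric] sum_nonneg del: sum_ennreal)
      finally show "ennreal (op_norm (U' x)) * indicator (cball 0 r) x
        \<le> (\<Sum>i\<in>UNIV. \<Sum>j\<in>UNIV. ennreal (norm (U' x $ i $ j)) * indicator (cball 0 r) x)"
        by (simp add: indicator_def)
    qed
    also have "\<dots> = (\<Sum>i\<in>UNIV. (\<integral>\<^sup>+x. (\<Sum>j\<in>UNIV. ennreal (norm (U' x $ i $ j)) * indicator (cball 0 r) x) \<partial>lborel))"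
      by (rule nn_integral_sum) measurable
    also have "\<dots> = (\<Sum>i\<in>UNIV. \<Sum>j\<in>UNIV. (\<integral>\<^sup>+x. ennreal (norm (U' x $ i $ j)) * indicator (cball 0 r) x \<partial>lborel))"
    proof (intro sum.cong refl nn_integral_sum)
      show "(\<lambda>x. ennreal (norm (U' x $ i $ j)) * indicator (cball 0 r) x) \<in> borel_measurable lborel" for i j
        by measurable
    qed
    also have "\<dots> < top"
      using entry by (simp add: ennreal_sum_less_top less_top)
    finally show ?thesis .
  qed
  have "pos_def (U' x)" for x
    using N(1) by (auto simp: U'_def pos_def_mat_1)
  with U' eq loc show ?thesis by blast
qed

lemma local_integrability_mat_powr:
  fixes U :: "real^'d \<Rightarrow> complex^'n^'n"
  assumes pos: "\<And>x. pos_def (U x)" and p: "0 < p"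
    and loc: "(\<integral>\<^sup>+x. ennreal (op_norm (U x)) * indicator (cball 0 r) x \<partial>lborel) < top"
  shows "(\<integral>\<^sup>+x. ennreal (op_norm (mat_powr (U x) (1 / p)) powr p) * indicator (cball 0 r) x \<partial>lborel) < top"
proof (rule le_less_trans[OF nn_integral_mono loc])
  fix x
  have "op_norm (mat_powr (U x) (1 / p)) powr p \<le> (op_norm (U x) powr (1 / p)) powr p"
    using p by (intro powr_mono2 op_norm_mat_powr_le pos op_norm_nonneg) auto
  also have "\<dots> = op_norm (U x)" using p op_norm_nonneg[of "U x"] by (simp add: powr_powr)
  finally show "ennreal (op_norm (mat_powr (U x) (1 / p)) powr p) * indicator (cball 0 r) x
      \<le> ennreal (op_norm (U x)) * indicator (cball 0 r) x"
    by (intro mult_right_mono ennreal_leI) auto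
qed

lemma borel_measurable_matrix_mult [measurable (raw)]:
  fixes F :: "'a \<Rightarrow> complex^'n^'m" and G :: "'a \<Rightarrow> complex^'l^'n"
  assumes "F \<in> borel_measurable M" "G \<in> borel_measurable M"
  shows "(\<lambda>x. F x ** G x) \<in> borel_measurable M"
proof (rule borel_measurable_continuous_Pair[OF assms])
  show "continuous_on UNIV (\<lambda>x :: (complex^'n^'m) \<times> (complex^'l^'n). fst x ** snd x)"
    unfolding matrix_matrix_mult_def by (intro continuous_intros)
qed

lemma Lp_norm_eq_energy:
  assumes "AE x in lborel. U x = U' x" "AE x in lborel. f x = f' x"
  shows "Lp_norm p U f = ennpowr (energy p (\<lambda>x. mat_powr (U' x) (1 / p)) f') (1 / p)"
proof -
  have "(\<integral>\<^sup>+x. ennreal (norm (mat_powr (U x) (1 / p) *v f x) powr p) \<partial>lborel)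
    = energy p (\<lambda>x. mat_powr (U' x) (1 / p)) f'"
    unfolding energy_def using assms by (intro nn_integral_cong_AE, eventually_elim) simp
  then show ?thesis by (simp add: Lp_norm_def nn_integral_completion)
qed

section \<open>From the two-weight condition to the kernel bound\<close>

lemma nn_avg_cube:
  fixes a :: "real^'d"
  assumes "0 < s" "AE x in lborel. h x = h' x"
  shows "nn_avg (cube a s) h = ennreal (1 / s ^ CARD('d)) * (\<integral>\<^sup>+x. h' x * indicator (cube a s) x \<partial>lborel)"
proof -
  have "(\<integral>\<^sup>+x. h x * indicator (cube a s) x \<partial>lborel) = (\<integral>\<^sup>+x. h' x * indicator (cube a s) x \<partial>lborel)"
    using assms(2) by (intro nn_integral_cong_AE, eventually_elim) simp
  then show ?thesis
    using assms(1)
    by (simp add: nn_avg_def nn_integral_completion emeasure_cube divide_ennreal_def inverse_ennreal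
      inverse_eq_divide mult.commute)
qed

lemma cube_in_cubes: "0 < s \<Longrightarrow> cube a s \<in> cubes"
  unfolding cubes_def by blast

definition weight_kernel :: "real \<Rightarrow> (real^'d \<Rightarrow> complex^'n^'n) \<Rightarrow> (real^'d \<Rightarrow> complex^'n^'n) \<Rightarrow> real^'d \<Rightarrow> real^'d \<Rightarrow> real" where
  "weight_kernel p U V x y = op_norm (mat_powr (U x) (1 / p) ** mat_powr (V y) (- 1 / p))"

lemma weight_kernel_nonneg: "0 \<le> weight_kernel p U V x y"
  unfolding weight_kernel_def by (rule op_norm_nonneg)

context
  fixes U V U' V' :: "real^'d \<Rightarrow> complex^'n^'n" and p :: real
  assumes Ap: "Ap_pair p U V"
    and U' [measurable]: "U' \<in> borel_measurable borel" and posU: "\<And>x. pos_def (U' x)" and eqU: "AE x in lborel. U x = U' x"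
    and V' [measurable]: "V' \<in> borel_measurable borel" and posV: "\<And>x. pos_def (V' x)" and eqV: "AE x in lborel. V x = V' x"
begin

lemma weight_kernel_borel:
  "(\<lambda>(x, y). weight_kernel p U' V' x y) \<in> borel_measurable (borel \<Otimes>\<^sub>M borel)"
proof -
  have [measurable]: "(\<lambda>x. mat_powr (U' x) r) \<in> borel_measurable borel"
    "(\<lambda>x. mat_powr (V' x) r) \<in> borel_measurable borel" for r
    by (intro borel_measurable_mat_powr posU posV U' V')+
  show ?thesis unfolding weight_kernel_def case_prod_beta by measurable
qed

lemma weight_kernel_borel' [measurable (raw)]:
  "f \<in> borel_measurable M \<Longrightarrow> g \<in> borel_measurable M \<Longrightarrow> (\<lambda>z. weight_kernel p U' V' (f z) (g z)) \<in> borel_measurable M"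
  using measurable_compose[OF measurable_Pair weight_kernel_borel, of f M g] by simp

text \<open>
  With \<open>q\<close> the conjugate exponent and \<open>J x\<close> the integral of \<open>k x y^q\<close> over \<open>y \<in> Q\<close>, Hoelder's inequality bounds the
  inner integral by \<open>(J x)^(p/q)\<close> times the integral of \<open>g^p\<close>, and the \<open>A\<^sub>p\<close> condition is a bound for the integral
  of \<open>(J x)^(p/q)\<close>. The powers of \<open>|Q|\<close> from the two averages combine through \<open>p/q + 1 = p\<close>.
\<close>

lemma cube_averaging_gt_1:
  assumes p: "1 < p"
  shows "\<exists>K\<ge>0. cube_averaging p K (weight_kernel p U' V')"
proof -
  define q where "q = conj_exp p"
  have q: "q > 1" "p / q + 1 = p"
    using p by (auto simp: q_def conj_exp_def divide_simps)
  let ?k = "weight_kernel p U' V'"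
  define A where "A = (SUP Q\<in>cubes. ennpowr (nn_avg Q (\<lambda>x. ennpowr (nn_avg Q (\<lambda>y. ennreal
     (op_norm (mat_powr (U x) (1 / p) ** mat_powr (V y) (- 1 / p)) powr conj_exp p))) (p / conj_exp p))) (1 / p))"
  have A: "A < top" using Ap p by (simp add: Ap_pair_def A_def)
  define K where "K = enn2real (ennpowr A p)"
  have K: "0 \<le> K" "ennreal K = ennpowr A p" using A by (auto simp: K_def)
  have "cube_averaging p K ?k"
    unfolding cube_averaging_def
  proof (intro allI impI)
    fix a :: "real^'d" and s :: real and g :: "real^'d \<Rightarrow> real"
    assume s: "0 < s" and [measurable]: "g \<in> borel_measurable borel" and g: "\<forall>y. 0 \<le> g y"
    define m where "m = s ^ CARD('d)"
    have m: "0 < m" using s by (simp add: m_def)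
    let ?Q = "cube a s"
    define J where "J x = (\<integral>\<^sup>+y. ennreal (?k x y powr q) * indicator ?Q y \<partial>lborel)" for x
    define I where "I x = (\<integral>\<^sup>+y. ennreal (?k x y * g y) * indicator ?Q y \<partial>lborel)" for x
    define G where "G = (\<integral>\<^sup>+y. ennreal (g y powr p) * indicator ?Q y \<partial>lborel)"
    have [measurable]: "J \<in> borel_measurable borel" "I \<in> borel_measurable borel"
      unfolding J_def I_def by measurable
    have Hoelder: "ennpowr (I x) p \<le> ennpowr (J x) (p / q) * G" for x
    proof -
      have "(\<lambda>y. ?k x y) \<in> borel_measurable (restrict_space lborel ?Q)" "g \<in> borel_measurable (restrict_space lborel ?Q)"
        by (intro measurable_restrict_space1; measurable)+
      from Hoelder_inequality[OF p this] g show ?thesis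
        by (simp add: nn_integral_restrict_space I_def J_def G_def q_def weight_kernel_nonneg)
    qed
    have bound: "(\<integral>\<^sup>+x. ennpowr (J x) (p / q) * indicator ?Q x \<partial>lborel) \<le> ennreal (K * m powr p)"
    proof -
      define R where "R = (\<integral>\<^sup>+x. ennpowr (ennreal (1 / m) * J x) (p / q) * indicator ?Q x \<partial>lborel)"
      have inner: "AE x in lborel. ennpowr (nn_avg ?Q (\<lambda>y. ennreal
         (op_norm (mat_powr (U x) (1 / p) ** mat_powr (V y) (- 1 / p)) powr conj_exp p))) (p / conj_exp p)
         = ennpowr (ennreal (1 / m) * J x) (p / q)"
        using eqU
      proof eventually_elim
        fix x assume x: "U x = U' x"
        have "nn_avg ?Q (\<lambda>y. ennreal (op_norm (mat_powr (U x) (1 / p) ** mat_powr (V y) (- 1 / p)) powr conj_exp p))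
          = ennreal (1 / m) * J x"
          unfolding m_def J_def weight_kernel_def q_def
          by (rule nn_avg_cube[OF s]) (use eqV in \<open>eventually_elim, simp add: x\<close>)
        then show "ennpowr (nn_avg ?Q (\<lambda>y. ennreal
         (op_norm (mat_powr (U x) (1 / p) ** mat_powr (V y) (- 1 / p)) powr conj_exp p))) (p / conj_exp p)
         = ennpowr (ennreal (1 / m) * J x) (p / q)" by (simp add: q_def)
      qed
      have "ennpowr (ennreal (1 / m) * R) (1 / p) \<le> A"
        unfolding A_def R_def m_def nn_avg_cube[OF s inner[unfolded m_def], symmetric]
        by (rule SUP_upper[OF cube_in_cubes[OF s]])
      then have "ennpowr (ennpowr (ennreal (1 / m) * R) (1 / p)) p \<le> ennpowr A p"
        using p by (intro ennpowr_mono) auto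
      then have R: "ennreal (1 / m) * R \<le> ennreal K"
        using p by (simp add: ennpowr_ennpowr K)
      have "ennpowr (J x) (p / q) = ennreal (m powr (p / q)) * ennpowr (ennreal (1 / m) * J x) (p / q)" for x
      proof -
        have "J x = ennreal m * (ennreal (1 / m) * J x)"
          using m by (simp add: mult.assoc[symmetric] flip: ennreal_mult)
        then have "ennpowr (J x) (p / q) = ennpowr (ennreal m * (ennreal (1 / m) * J x)) (p / q)" by simp
        then show ?thesis using m by (simp add: ennpowr_mult[of "ennreal m"] ennpowr_ennreal)
      qed
      then have "(\<integral>\<^sup>+x. ennpowr (J x) (p / q) * indicator ?Q x \<partial>lborel)
        = (\<integral>\<^sup>+x. ennreal (m powr (p / q)) * (ennpowr (ennreal (1 / m) * J x) (p / q) * indicator ?Q x) \<partial>lborel)"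
        by (simp add: mult.assoc)
      also have "\<dots> = ennreal (m powr (p / q)) * R"
        unfolding R_def by (rule nn_integral_cmult) measurable
      also have "\<dots> = ennreal (m powr (p / q)) * (ennreal m * (ennreal (1 / m) * R))"
        using m by (simp add: mult.assoc[symmetric] flip: ennreal_mult)
      also have "\<dots> \<le> ennreal (m powr (p / q)) * (ennreal m * ennreal K)"
        by (intro mult_left_mono R) auto
      also have "\<dots> = ennreal (K * m powr p)"
      proof -
        have "m powr (p / q) * m = m powr (p / q + 1)" using m by (simp add: powr_add)
        then show ?thesis
          using m K(1) unfolding q(2) by (simp add: mult.commute mult.left_commute flip: ennreal_mult)
      qed
      finally show ?thesis .
    qed
    have "(\<integral>\<^sup>+x. ennpowr (I x) p * indicator ?Q x \<partial>lborel)
      \<le> (\<integral>\<^sup>+x. (ennpowr (J x) (p / q) * indicator ?Q x) * G \<partial>lborel)"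
      using Hoelder by (intro nn_integral_mono) (auto simp: indicator_def)
    also have "\<dots> = (\<integral>\<^sup>+x. ennpowr (J x) (p / q) * indicator ?Q x \<partial>lborel) * G"
      by (rule nn_integral_multc) measurable
    also have "\<dots> \<le> ennreal (K * m powr p) * G"
      by (intro mult_right_mono bound) auto
    finally show "(\<integral>\<^sup>+x. ennpowr (\<integral>\<^sup>+y. ennreal (?k x y * g y) * indicator ?Q y \<partial>lborel) p * indicator ?Q x \<partial>lborel)
      \<le> ennreal (K * (s ^ CARD('d)) powr p) * (\<integral>\<^sup>+y. ennreal (g y powr p) * indicator ?Q y \<partial>lborel)"
      by (simp add: I_def G_def m_def)
  qed
  then show ?thesis using K by blast
qed

text \<open>
  After exchanging the integrals, the inner one is the average that the \<open>A\<^sub>1\<close> condition bounds for almost every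
  \<open>y\<close>.
\<close>

lemma cube_averaging_eq_1:
  assumes p: "p = 1"
  shows "\<exists>K\<ge>0. cube_averaging p K (weight_kernel p U' V')"
proof -
  let ?k = "weight_kernel p U' V'"
  define A where "A = (SUP Q\<in>cubes. esssup (lebesgue_on Q)
     (\<lambda>y. nn_avg Q (\<lambda>x. ennreal (op_norm (U x ** mat_powr (V y) (- 1))))))"
  have A: "A < top" using Ap p by (simp add: Ap_pair_def A_def)
  define K where "K = enn2real A"
  have K: "0 \<le> K" "ennreal K = A" using A by (auto simp: K_def)
  have "cube_averaging p K ?k"
    unfolding cube_averaging_def
  proof (intro allI impI)
    fix a :: "real^'d" and s :: real and g :: "real^'d \<Rightarrow> real"
    assume s: "0 < s" and [measurable]: "g \<in> borel_measurable borel" and g: "\<forall>y. 0 \<le> g y"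
    define m where "m = s ^ CARD('d)"
    have m: "0 < m" using s by (simp add: m_def)
    let ?Q = "cube a s"
    have "AE y in lebesgue_on ?Q. nn_avg ?Q (\<lambda>x. ennreal (op_norm (U x ** mat_powr (V y) (- 1)))) \<le> A"
    proof -
      have "esssup (lebesgue_on ?Q) (\<lambda>y. nn_avg ?Q (\<lambda>x. ennreal (op_norm (U x ** mat_powr (V y) (- 1))))) \<le> A"
        unfolding A_def by (rule SUP_upper[OF cube_in_cubes[OF s]])
      from order_trans[OF _ this] show ?thesis by (rule eventually_mono[OF esssup_AE])
    qed
    then have "AE y in lborel. y \<in> ?Q \<longrightarrow> nn_avg ?Q (\<lambda>x. ennreal (op_norm (U x ** mat_powr (V y) (- 1)))) \<le> A"
      by (simp add: AE_restrict_space_iff AE_completion_iff)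
    then have bound: "AE y in lborel. y \<in> ?Q \<longrightarrow> (\<integral>\<^sup>+x. ennreal (?k x y) * indicator ?Q x \<partial>lborel) \<le> ennreal (K * m)"
      using eqV
    proof eventually_elim
      fix y assume y: "y \<in> ?Q \<longrightarrow> nn_avg ?Q (\<lambda>x. ennreal (op_norm (U x ** mat_powr (V y) (- 1)))) \<le> A" "V y = V' y"
      have "nn_avg ?Q (\<lambda>x. ennreal (op_norm (U x ** mat_powr (V y) (- 1))))
         = ennreal (1 / m) * (\<integral>\<^sup>+x. ennreal (?k x y) * indicator ?Q x \<partial>lborel)"
        unfolding m_def weight_kernel_def
        by (rule nn_avg_cube[OF s])
          (use eqU in \<open>eventually_elim, simp add: y p mat_powr_one posU\<close>)
      then show "y \<in> ?Q \<longrightarrow> (\<integral>\<^sup>+x. ennreal (?k x y) * indicator ?Q x \<partial>lborel) \<le> ennreal (K * m)"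
      proof (intro impI)
        let ?R = "\<integral>\<^sup>+x. ennreal (?k x y) * indicator ?Q x \<partial>lborel"
        assume "nn_avg ?Q (\<lambda>x. ennreal (op_norm (U x ** mat_powr (V y) (- 1)))) = ennreal (1 / m) * ?R" "y \<in> ?Q"
        then have "ennreal (1 / m) * ?R \<le> ennreal K" using y K by simp
        then have "ennreal m * (ennreal (1 / m) * ?R) \<le> ennreal m * ennreal K"
          by (intro mult_left_mono) auto
        then show "?R \<le> ennreal (K * m)"
          using m K(1) by (simp add: mult.assoc[symmetric] mult.commute[of m] flip: ennreal_mult)
      qed
    qed
    have "(\<integral>\<^sup>+x. ennpowr (\<integral>\<^sup>+y. ennreal (?k x y * g y) * indicator ?Q y \<partial>lborel) p * indicator ?Q x \<partial>lborel)
      = (\<integral>\<^sup>+x. (\<integral>\<^sup>+y. ennreal (?k x y * g y) * indicator ?Q y * indicator ?Q x \<partial>lborel) \<partial>lborel)"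
      unfolding p ennpowr_one by (subst nn_integral_multc) (auto simp flip: p)
    also have "\<dots> = (\<integral>\<^sup>+y. (\<integral>\<^sup>+x. ennreal (?k x y * g y) * indicator ?Q y * indicator ?Q x \<partial>lborel) \<partial>lborel)"
      by (rule lborel_pair.Fubini') measurable
    also have "\<dots> = (\<integral>\<^sup>+y. (\<integral>\<^sup>+x. (ennreal (g y) * indicator ?Q y) * (ennreal (?k x y) * indicator ?Q x) \<partial>lborel) \<partial>lborel)"
      using g by (intro nn_integral_cong) (simp add: ennreal_mult' mult_ac)
    also have "\<dots> = (\<integral>\<^sup>+y. (ennreal (g y) * indicator ?Q y) * (\<integral>\<^sup>+x. ennreal (?k x y) * indicator ?Q x \<partial>lborel) \<partial>lborel)"
      by (subst nn_integral_cmult) auto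
    also have "\<dots> \<le> (\<integral>\<^sup>+y. (ennreal (g y) * indicator ?Q y) * ennreal (K * m) \<partial>lborel)"
      using bound by (intro nn_integral_mono_AE, eventually_elim) (auto simp: indicator_def intro!: mult_left_mono)
    also have "\<dots> = (\<integral>\<^sup>+y. ennreal (g y) * indicator ?Q y \<partial>lborel) * ennreal (K * m)"
      by (rule nn_integral_multc) measurable
    finally show "(\<integral>\<^sup>+x. ennpowr (\<integral>\<^sup>+y. ennreal (?k x y * g y) * indicator ?Q y \<partial>lborel) p * indicator ?Q x \<partial>lborel)
      \<le> ennreal (K * (s ^ CARD('d)) powr p) * (\<integral>\<^sup>+y. ennreal (g y powr p) * indicator ?Q y \<partial>lborel)"
      using m g by (simp add: p m_def mult.commute)
  qed
  then show ?thesis using K by blast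
qed

end

lemma Ap_pair_imp_weight_pair:
  fixes U V U' V' :: "real^'d \<Rightarrow> complex^'n^'n"
  assumes p: "1 \<le> p" and Ap: "Ap_pair p U V"
    and U: "U' \<in> borel_measurable borel" "\<And>x. pos_def (U' x)" "AE x in lborel. U x = U' x"
      "\<And>r. (\<integral>\<^sup>+x. ennreal (op_norm (U' x)) * indicator (cball 0 r) x \<partial>lborel) < top"
    and V: "V' \<in> borel_measurable borel" "\<And>x. pos_def (V' x)" "AE x in lborel. V x = V' x"
      "\<And>r. (\<integral>\<^sup>+x. ennreal (op_norm (V' x)) * indicator (cball 0 r) x \<partial>lborel) < top"
  shows "\<exists>K. weight_pair (\<lambda>x. mat_powr (U' x) (1 / p)) (\<lambda>x. mat_powr (V' x) (1 / p)) (weight_kernel p U' V') p K"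
proof -
  note prems = Ap U(1-3) V(1-3)
  obtain K where K: "0 \<le> K" "cube_averaging p K (weight_kernel p U' V')"
    using cube_averaging_gt_1[OF prems] cube_averaging_eq_1[OF prems] p by (cases "p = 1") auto
  have "weight_pair (\<lambda>x. mat_powr (U' x) (1 / p)) (\<lambda>x. mat_powr (V' x) (1 / p)) (weight_kernel p U' V') p K"
  proof
    show "(\<lambda>x. mat_powr (U' x) (1 / p)) \<in> borel_measurable borel" "(\<lambda>x. mat_powr (V' x) (1 / p)) \<in> borel_measurable borel"
      by (intro borel_measurable_mat_powr U V)+
    show "(\<lambda>(x, y). weight_kernel p U' V' x y) \<in> borel_measurable (borel \<Otimes>\<^sub>M borel)"
      by (rule weight_kernel_borel[OF prems])
    show "0 \<le> weight_kernel p U' V' x y" for x y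
      unfolding weight_kernel_def by (rule op_norm_nonneg)
    show "norm (mat_powr (U' x) (1 / p) *v v) \<le> weight_kernel p U' V' x y * norm (mat_powr (V' y) (1 / p) *v v)" for x y v
    proof -
      have "mat_powr (V' y) (- 1 / p) ** mat_powr (V' y) (1 / p) = mat 1"
        using mat_powr_inverse[OF V(2), of y "1 / p"] by simp
      then have "mat_powr (U' x) (1 / p) *v v
        = (mat_powr (U' x) (1 / p) ** mat_powr (V' y) (- 1 / p)) *v (mat_powr (V' y) (1 / p) *v v)"
        by (simp add: matrix_vector_mul_assoc flip: matrix_mul_assoc)
      then show ?thesis unfolding weight_kernel_def by (metis norm_le_op_norm)
    qed
    show "\<exists>c. \<forall>v. norm v \<le> c * norm (mat_powr (U' x) (1 / p) *v v)" for x
    proof (intro exI allI)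
      fix v
      have "v = mat_powr (U' x) (- (1 / p)) *v (mat_powr (U' x) (1 / p) *v v)"
        using mat_powr_inverse[OF U(2), of x "1 / p"] by (simp add: matrix_vector_mul_assoc)
      then show "norm v \<le> op_norm (mat_powr (U' x) (- (1 / p))) * norm (mat_powr (U' x) (1 / p) *v v)"
        by (metis norm_le_op_norm)
    qed
  qed (use p K U V in \<open>auto intro!: local_integrability_mat_powr\<close>)
  then show ?thesis ..
qed

section \<open>Boundedness and convergence of mollifiers\<close>

lemma mollifier_of_Cc_infinity:
  fixes \<phi> :: "real^'d \<Rightarrow> real"
  assumes "\<phi> \<in> Cc_infinity (ball 0 1)" "\<forall>x. 0 \<le> \<phi> x" "radially_decreasing \<phi>"
    "(LINT x|lebesgue. \<bar>\<phi> x\<bar>) = 1"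
  shows "mollifier \<phi> (\<phi> 0)"
proof
  have "Ck 0 \<phi>" using assms(1) unfolding Cc_infinity_def by blast
  then show cont: "continuous_on UNIV \<phi>" by simp
  then have [measurable]: "\<phi> \<in> borel_measurable borel" by (rule borel_measurable_continuous_onI)
  show "0 \<le> \<phi> x" "\<phi> x \<le> \<phi> 0" for x
    using assms(2,3) by (auto simp: radially_decreasing_def)
  show "\<phi> x = 0" if "1 \<le> norm x" for x
  proof (rule ccontr)
    assume "\<phi> x \<noteq> 0"
    then have "x \<in> closure {x. \<phi> x \<noteq> 0}" using closure_subset[of "{x. \<phi> x \<noteq> 0}"] by auto
    then show False using assms(1) that by (auto simp: Cc_infinity_def)
  qed
  have "(LINT x|lborel. \<phi> x) = 1"
    using assms(2,4) by (simp add: integral_completion)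
  then show "has_bochner_integral lborel \<phi> 1"
    using not_integrable_integral_eq[of lborel \<phi>] by (auto simp: has_bochner_integral_iff)
qed

lemma (in mollified_weight_pair) convolve_eq_mollify:
  fixes f f' :: "real^'d \<Rightarrow> complex^'n"
  assumes f: "f \<in> borel_measurable lebesgue" and f' [measurable]: "f' \<in> borel_measurable borel"
    and eq: "AE x in lborel. f x = f' x" and fin: "energy p S f' < top" and t: "0 < t"
  shows "convolution_exists (dilate \<phi> t) f" "convolve (dilate \<phi> t) f = mollify f' t"
proof -
  have meas: "(\<lambda>y. complex_of_real (dilate \<phi> t (x - y)) * f' y $ i) \<in> borel_measurable lborel" for x i
    by measurable
  have meas': "(\<lambda>y. complex_of_real (dilate \<phi> t (x - y)) * f y $ i) \<in> borel_measurable lebesgue" for x i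
  proof -
    have "(\<lambda>y. complex_of_real (dilate \<phi> t (x - y))) \<in> borel_measurable lebesgue"
      by (intro measurable_completion) measurable
    moreover have "(\<lambda>y. f y $ i) \<in> borel_measurable lebesgue"
      using f by measurable
    ultimately show ?thesis by (rule borel_measurable_times)
  qed
  have AE: "AE y in lebesgue. complex_of_real (dilate \<phi> t (x - y)) * f y $ i
      = complex_of_real (dilate \<phi> t (x - y)) * f' y $ i" for x i
    unfolding AE_completion_iff using eq by eventually_elim simp
  have nth: "(\<lambda>y. complex_of_real (dilate \<phi> t (x - y)) * f' y $ i) = (\<lambda>y. (dilate \<phi> t (x - y) *\<^sub>R f' y) $ i)" for x i
    by (simp add: scaleR_conv_of_real[where 'a=complex])
  note int = integrable_mollify[OF f' fin t]
  have "integrable lebesgue (\<lambda>y. complex_of_real (dilate \<phi> t (x - y)) * f y $ i)" for x i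
  proof -
    have "integrable lborel (\<lambda>y. complex_of_real (dilate \<phi> t (x - y)) * f' y $ i)"
      unfolding nth by (rule integrable_bounded_linear[OF bounded_linear_vec_nth int])
    then show ?thesis
      by (simp only: integrable_cong_AE[OF meas' measurable_completion[OF meas] AE] integrable_completion[OF meas])
  qed
  then show "convolution_exists (dilate \<phi> t) f" by (simp add: convolution_exists_def)
  have "convolve (dilate \<phi> t) f x $ i = mollify f' t x $ i" for x i
  proof -
    have "convolve (dilate \<phi> t) f x $ i = (LINT y|lborel. complex_of_real (dilate \<phi> t (x - y)) * f' y $ i)"
      unfolding convolve_def
      by (simp only: vec_lambda_beta integral_cong_AE[OF meas' measurable_completion[OF meas] AE]
        integral_completion[OF meas])
    also have "\<dots> = mollify f' t x $ i"
      unfolding nth mollify_def by (rule integral_bounded_linear[OF bounded_linear_vec_nth int])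
    finally show ?thesis .
  qed
  then show "convolve (dilate \<phi> t) f = mollify f' t" by (simp add: fun_eq_iff vec_eq_iff)
qed

theorem corollary6p1:
  fixes U V :: "real^'d \<Rightarrow> complex^'n^'n"
    and p :: real
    and \<phi> :: "real^'d \<Rightarrow> real"
  assumes "1 \<le> p"
    and "matrix_weight U" and "matrix_weight V"
    and "Ap_pair p U V"
    and "\<phi> \<in> Cc_infinity (ball 0 1)"
    and "\<forall>x. 0 \<le> \<phi> x"
    and "radial \<phi>" and "radially_decreasing \<phi>"
    and "(LINT x|lebesgue. \<bar>\<phi> x\<bar>) = 1"
  shows "(\<forall>f \<in> Lp_space p V. \<forall>t>0. convolution_exists (dilate \<phi> t) f) \<and>
    (\<exists>C::real. 0 \<le> C \<and> (\<forall>f \<in> Lp_space p V.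
       (SUP t\<in>{0<..}. Lp_norm p U (convolve (dilate \<phi> t) f)) \<le> ennreal C * Lp_norm p V f)) \<and>
    (\<forall>f \<in> Lp_space p V.
       ((\<lambda>t. Lp_norm p U (\<lambda>x. convolve (dilate \<phi> t) f x - f x)) \<longlongrightarrow> 0) (at_right 0))"
proof -
  obtain U' where U: "U' \<in> borel_measurable borel" "\<And>x. pos_def (U' x)" "AE x in lborel. U x = U' x"
      "\<And>r. (\<integral>\<^sup>+x. ennreal (op_norm (U' x)) * indicator (cball 0 r) x \<partial>lborel) < top"
    using matrix_weight_borel_version[OF \<open>matrix_weight U\<close>] by blast
  obtain V' where V: "V' \<in> borel_measurable borel" "\<And>x. pos_def (V' x)" "AE x in lborel. V x = V' x"
      "\<And>r. (\<integral>\<^sup>+x. ennreal (op_norm (V' x)) * indicator (cball 0 r) x \<partial>lborel) < top"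
    using matrix_weight_borel_version[OF \<open>matrix_weight V\<close>] by blast
  define W where "W x = mat_powr (U' x) (1 / p)" for x
  define S where "S x = mat_powr (V' x) (1 / p)" for x
  obtain K where "weight_pair W S (weight_kernel p U' V') p K"
    using Ap_pair_imp_weight_pair[OF assms(1,4) U V] unfolding W_def S_def by blast
  then interpret weight_pair W S "weight_kernel p U' V'" p K .
  interpret mollifier \<phi> "\<phi> 0"
    using assms by (intro mollifier_of_Cc_infinity)
  interpret mollified_weight_pair W S "weight_kernel p U' V'" p K \<phi> "\<phi> 0" ..
  have version: "\<exists>f'. f' \<in> borel_measurable borel \<and> (AE x in lborel. f x = f' x) \<and> energy p S f' < top \<and>
      Lp_norm p V f = ennpowr (energy p S f') (1 / p)" if "f \<in> Lp_space p V" for f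
  proof -
    have f: "f \<in> borel_measurable lebesgue" "Lp_norm p V f < top"
      using that by (auto simp: Lp_space_def)
    obtain f' where f': "f' \<in> borel_measurable borel" "AE x in lborel. f x = f' x"
      using lebesgue_measurable_borel_version[OF f(1)] by blast
    have "Lp_norm p V f = ennpowr (energy p S f') (1 / p)"
      using Lp_norm_eq_energy[OF V(3) f'(2), of p] unfolding S_def .
    then show ?thesis using f f' by auto
  qed
  define C where "C = mollify_const powr (1 / p)"
  have "convolution_exists (dilate \<phi> t) f" if "f \<in> Lp_space p V" "0 < t" for f t
    using version[OF that(1)] that convolve_eq_mollify(1) by (auto simp: Lp_space_def)
  moreover have "Lp_norm p U (convolve (dilate \<phi> t) f) \<le> ennreal C * Lp_norm p V f"
    if f: "f \<in> Lp_space p V" and t: "0 < t" for f t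
  proof -
    obtain f' where f': "f' \<in> borel_measurable borel" "AE x in lborel. f x = f' x" "energy p S f' < top"
      "Lp_norm p V f = ennpowr (energy p S f') (1 / p)"
      using version[OF f] by blast
    have "convolve (dilate \<phi> t) f = mollify f' t"
      using f t f' by (intro convolve_eq_mollify) (auto simp: Lp_space_def)
    then have "Lp_norm p U (convolve (dilate \<phi> t) f) = ennpowr (energy p W (mollify f' t)) (1 / p)"
      using Lp_norm_eq_energy[OF U(3), of "mollify f' t" "mollify f' t" p] unfolding W_def by simp
    also have "\<dots> \<le> ennpowr (ennreal mollify_const * energy p S f') (1 / p)"
      using f' t p_pos by (intro ennpowr_mono energy_mollify_le) auto
    also have "\<dots> = ennreal C * Lp_norm p V f"
      using mollify_const_nonneg by (simp add: ennpowr_mult ennpowr_ennreal C_def f')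
    finally show ?thesis .
  qed
  moreover have "((\<lambda>t. Lp_norm p U (\<lambda>x. convolve (dilate \<phi> t) f x - f x)) \<longlongrightarrow> 0) (at_right 0)"
    if f: "f \<in> Lp_space p V" for f
  proof -
    obtain f' where f': "f' \<in> borel_measurable borel" "AE x in lborel. f x = f' x" "energy p S f' < top"
      using version[OF f] by blast
    have "\<forall>\<^sub>F t in at_right 0. ennpowr (energy p W (\<lambda>x. mollify f' t x - f' x)) (1 / p)
      = Lp_norm p U (\<lambda>x. convolve (dilate \<phi> t) f x - f x)"
      using eventually_at_right_less[of 0]
    proof eventually_elim
      fix t :: real assume t: "0 < t"
      have "convolve (dilate \<phi> t) f = mollify f' t"
        using f t f' by (intro convolve_eq_mollify) (auto simp: Lp_space_def)
      then have "AE x in lborel. convolve (dilate \<phi> t) f x - f x = mollify f' t x - f' x"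
        using f'(2) by (auto elim: eventually_mono)
      from Lp_norm_eq_energy[OF U(3) this, of p]
      show "ennpowr (energy p W (\<lambda>x. mollify f' t x - f' x)) (1 / p)
        = Lp_norm p U (\<lambda>x. convolve (dilate \<phi> t) f x - f x)"
        unfolding W_def by simp
    qed
    moreover have "((\<lambda>t. ennpowr (energy p W (\<lambda>x. mollify f' t x - f' x)) (1 / p)) \<longlongrightarrow> 0) (at_right 0)"
      using p_pos f' by (intro tendsto_ennpowr_0 energy_mollify_tendsto) auto
    ultimately show ?thesis by (rule Lim_transform_eventually[rotated])
  qed
  moreover have "0 \<le> C" by (simp add: C_def)
  ultimately show ?thesis
    by (intro conjI exI[of _ C] ballI allI impI SUP_least) auto
qed

end
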